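(* Let $G$ be an infinite discrete countable group and let $(X,G)$ be a minimal $G$-system. Let $(H,G)$ be the maximal equicontinuous factor of $(X,G)$ with factor map $\pi:X\to H$ and let $\nu$ be the Haar measure on $H$. Let $K_1\in\mathbb{N}\cup\{\infty\}$ and $K_2\in\mathbb{N}$ be such that (1) $\nu(\{y\in H:|\pi^{-1}(y)|=K_1\})=1$; and (2) $\pi$ is almost $K_2$ to one. If $\lceil K_1/K_2\rceil\ge 2$, then for every $K\in\mathbb{N}$ with $2\le K\le \lceil K_1/K_2\rceil$, $(X,G)$ has a non-trivial $K$-IT-tuple, i.e. $\mathrm{IT}_K(X,G)\setminus\triangle^{(K)}(X)\neq\emptyset$.
   Context: A $G$-system is a compact metric space $X$ with a $G$-action by homeomorphisms; minimal means every orbit is dense. The maximal equicontinuous factor $(H,G)$ is $X/S_{eq}$ where $S_{eq}$ is the smallest closed $G$-invariant equivalence relation with equicontinuous quotient; $\pi$ is the quotient map; $\nu$ is the unique $G$-invariant Borel probability measure on $H$ (Haar measure). $\pi$ is almost $K_2$ to one if $\{h\in H:|\pi^{-1}(h)|=K_2\}$ is residual in $H$. For a tuple $(A_1,\dots,A_k)$ of subsets of $X$, a set $J\subset G$ is an independence set if for every nonempty finite $I\subset J$ and every $\sigma:I\to\{1,\dots,k\}$, $\bigcap_{s\in I}s^{-1}A_{\sigma(s)}\neq\emptyset$. A tuple $(x_1,\dots,x_n)\in X^n$ is an IT-tuple of length $n$ if for every product neighborhood $U_1\times\cdots\times U_n$ of it, $(U_1,\dots,U_n)$ has an infinite independence set;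 $\mathrm{IT}_n(X,G)$ denotes the set of these. $\triangle^{(n)}(X)=\{(x_1,\dots,x_n)\in X^n: x_i=x_j\text{ for some }i\neq j\}$. $\lceil\infty/K_2\rceil=\infty$. *)

theory Defs
  imports "HOL-Probability.Probability"
begin

text \<open>A G-action on a topological space by homeomorphisms (G a group, written additively
  via the class group_add, which is NOT assumed commutative).\<close>
definition G_system :: "('g::group_add \<Rightarrow> 'x::topological_space \<Rightarrow> 'x) \<Rightarrow> bool" where
  "G_system act \<longleftrightarrow> (\<forall>x. act 0 x = x) \<and> (\<forall>g h x. act (g + h) x = act g (act h x))
     \<and> (\<forall>g. continuous_on UNIV (act g))"

definition minimal_system :: "('g \<Rightarrow> 'x::topological_space \<Rightarrow> 'x) \<Rightarrow> bool" where
  "minimal_system act \<longleftrightarrow> (\<forall>x. closure (range (\<lambda>g. act g x)) = UNIV)"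

definition equicontinuous_on :: "'y::metric_space set \<Rightarrow> ('g \<Rightarrow> 'y \<Rightarrow> 'y) \<Rightarrow> bool" where
  "equicontinuous_on Y a \<longleftrightarrow> (\<forall>e>0. \<exists>d>0. \<forall>y\<in>Y. \<forall>y'\<in>Y.
      dist y y' < d \<longrightarrow> (\<forall>g. dist (a g y) (a g y') < e))"

text \<open>The quotient X/R is (realised as) an equicontinuous G-system: there is a compact
  metrizable G-system Y (every compact metrizable space embeds in the product space
  nat => real) and a continuous surjective equivariant map p : X -> Y whose fibre relation is R.\<close>
definition quotient_equicontinuous ::
  "('g \<Rightarrow> 'x::topological_space \<Rightarrow> 'x) \<Rightarrow> ('x \<times> 'x) set \<Rightarrow> bool" where
  "quotient_equicontinuous act R \<longleftrightarrow>
     (\<exists>(Y :: (nat \<Rightarrow> real) set) (actY :: 'g \<Rightarrow> (nat \<Rightarrow> real) \<Rightarrow> (nat \<Rightarrow> real)) p.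
        compact Y \<and> continuous_on UNIV p \<and> range p = Y
      \<and> (\<forall>g. actY g ` Y \<subseteq> Y \<and> continuous_on Y (actY g))
      \<and> (\<forall>g x. p (act g x) = actY g (p x))
      \<and> equicontinuous_on Y actY
      \<and> R = {(x, y). p x = p y})"

definition S_eq :: "('g \<Rightarrow> 'x::topological_space \<Rightarrow> 'x) \<Rightarrow> ('x \<times> 'x) set" where
  "S_eq act = \<Inter>{R. closed R \<and> equiv UNIV R
       \<and> (\<forall>g x y. (x, y) \<in> R \<longrightarrow> (act g x, act g y) \<in> R)
       \<and> quotient_equicontinuous act R}"

definition max_equicontinuous_factor ::
  "('g::group_add \<Rightarrow> 'x::metric_space \<Rightarrow> 'x) \<Rightarrow> ('g \<Rightarrow> 'h::metric_space \<Rightarrow> 'h)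
     \<Rightarrow> ('x \<Rightarrow> 'h) \<Rightarrow> bool" where
  "max_equicontinuous_factor act actH \<pi> \<longleftrightarrow>
     compact (UNIV :: 'h set) \<and> G_system actH \<and> equicontinuous_on UNIV actH
   \<and> continuous_on UNIV \<pi> \<and> surj \<pi> \<and> (\<forall>g x. \<pi> (act g x) = actH g (\<pi> x))
   \<and> {(x, y). \<pi> x = \<pi> y} = S_eq act"

text \<open>The (unique) G-invariant Borel probability measure on H.\<close>
definition haar_measure :: "('g \<Rightarrow> 'h::topological_space \<Rightarrow> 'h) \<Rightarrow> 'h measure \<Rightarrow> bool" where
  "haar_measure actH \<nu> \<longleftrightarrow> prob_space \<nu> \<and> sets \<nu> = sets borel
     \<and> (\<forall>g A. A \<in> sets borel \<longrightarrow> emeasure \<nu> (actH g -` A) = emeasure \<nu> A)"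

definition fibre_card :: "('x \<Rightarrow> 'h) \<Rightarrow> 'h \<Rightarrow> enat" where
  "fibre_card \<pi> y = (if finite (\<pi> -` {y}) then enat (card (\<pi> -` {y})) else \<infinity>)"

definition residual :: "'a::topological_space set \<Rightarrow> bool" where
  "residual S \<longleftrightarrow> (\<exists>F :: nat \<Rightarrow> 'a set. (\<forall>n. open (F n) \<and> closure (F n) = UNIV)
                      \<and> (\<Inter>n. F n) \<subseteq> S)"

definition almost_K_to_one :: "('x \<Rightarrow> 'h::topological_space) \<Rightarrow> nat \<Rightarrow> bool" where
  "almost_K_to_one \<pi> K \<longleftrightarrow> residual {h. fibre_card \<pi> h = enat K}"

definition ceil_div :: "enat \<Rightarrow> nat \<Rightarrow> enat" where
  "ceil_div K1 K2 = (case K1 of \<infinity> \<Rightarrow> \<infinity>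
                      | enat k \<Rightarrow> enat (nat \<lceil>real k / real K2\<rceil>))"

definition independence_set ::
  "('g \<Rightarrow> 'x \<Rightarrow> 'x) \<Rightarrow> 'x set list \<Rightarrow> 'g set \<Rightarrow> bool" where
  "independence_set act As J \<longleftrightarrow>
     (\<forall>I \<sigma>. finite I \<and> I \<noteq> {} \<and> I \<subseteq> J \<and> (\<forall>s\<in>I. \<sigma> s < length As) \<longrightarrow>
        (\<Inter>s\<in>I. act s -` (As ! \<sigma> s)) \<noteq> {})"

definition IT_tuple :: "('g \<Rightarrow> 'x::topological_space \<Rightarrow> 'x) \<Rightarrow> 'x list \<Rightarrow> bool" where
  "IT_tuple act xs \<longleftrightarrow>
     (\<forall>Us. length Us = length xs \<and> (\<forall>i<length xs. open (Us ! i) \<and> xs ! i \<in> Us ! i) \<longrightarrow>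
        (\<exists>J. infinite J \<and> independence_set act Us J))"

definition IT :: "nat \<Rightarrow> ('g \<Rightarrow> 'x::topological_space \<Rightarrow> 'x) \<Rightarrow> 'x list set" where
  "IT n act = {xs. length xs = n \<and> IT_tuple act xs}"

definition diag :: "nat \<Rightarrow> 'x list set" where
  "diag n = {xs. length xs = n \<and> (\<exists>i<n. \<exists>j<n. i \<noteq> j \<and> xs ! i = xs ! j)}"

end

(*
Put N = (K - 1) K2 + 1. Almost every fibre of pi has at least N points, so some fibre contains
distinct points x_1, ..., x_N such that for all e > 0 the images pi(B(x_j, e)) have an intersection D
of positive measure. Minimality makes D a subset of the closure of each W_j = int pi(B(x_j, e)).
Since nu(D) > 0, translates of D behave continuously in measure, and one constructs inductively
group elements s_1, s_2, ... such that every word over {1, ..., N} is realised: some h in H satisfies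
s_i h : W_(w_i) for all i. For a generic h the fibre has K2 points, so each word splits into K2 parts
which are realised in X by a single point each. An infinite Ramsey argument (Nash-Williams) makes
the splitting depend on the symbol only; as N > (K - 1) K2, some K symbols share a part, which yields
an infinite independence set for K of the balls. Letting e tend to 0 gives the IT-tuple.
*)
theory Submission
  imports Defs
begin

section \<open>Extraction of infinite sets of uniform patterns\<close>

text \<open>Over a generic \<open>h\<close> every symbol of a word is realised by some point of the
  fibre, but which of the \<open>K2\<close> points realises it may depend on the whole word. The
  colouring to be made uniform thus concerns finite sequences of unbounded length, beyond Ramsey's
  theorem for a fixed exponent. The number \<open>N\<close> is the threshold above which
  \<open>K2\<close> colours on \<open>N\<close> symbols force \<open>K\<close> symbols of equal
  colour.

  The two hypotheses on fibres may concern disjoint sets of points of \<open>H\<close>: the measure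
  condition yields the tuple and \<open>D\<close>, while fibres with \<open>K2\<close> points are
  known only on a residual set, possibly a null set. They meet through openness of the
  \<open>W j\<close>: the conditions on \<open>h\<close> given by a finite word are open, so
  \<open>h\<close> can be moved into the residual set.

  The delicate point of the induction is that each point of \<open>H\<close> found so far must
  branch into \<open>N\<close> nearby points, and a single group element must still move all of them
  close to \<open>D\<close>. Positivity of a frequency along finite lists of group elements, uniform
  in the precision, is the invariant that survives this branching.\<close>

lemma compact_UNIV_bool_fun: "compact (UNIV :: ('a \<Rightarrow> bool) set)"
proof -
  have "compact_space (product_topology (\<lambda>_::'a. euclidean :: bool topology) UNIV)"
    by (intro iffD2[OF compact_space_product_topology] disjI2 ballI) (simp add: finite_imp_compact compact_space_def)
  then show ?thesis
    by (simp add: euclidean_product_topology compact_space_def)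
qed

text \<open>Each number is sent by \<open>ev\<close> to its principal ultrafilter, seen as a point
  of a power of \<open>bool\<close>. A cluster point \<open>x\<close> exists by compactness, and
  pulling its neighbourhoods back and adding \<open>sequentially\<close> gives \<open>p\<close>.
  Every coordinate of \<open>x\<close> is a clopen condition, so \<open>p\<close> decides every
  predicate.\<close>

lemma free_ultrafilter_exists:
  "\<exists>p. p \<noteq> bot \<and> p \<le> sequentially \<and> (\<forall>P. eventually P p \<or> eventually (\<lambda>n::nat. \<not> P n) p)"
proof -
  define ev where "ev = (\<lambda>(n::nat) A. n \<in> A)"
  have "filtermap ev sequentially \<noteq> bot" by (simp add: filtermap_bot_iff)
  with compact_UNIV_bool_fun[unfolded compact_filter, rule_format, of "filtermap ev sequentially"]
  obtain x where x: "inf (nhds x) (filtermap ev sequentially) \<noteq> bot"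
    by auto
  define p where "p = inf sequentially (filtercomap ev (nhds x))"
  have "p \<noteq> bot"
  proof
    assume "p = bot"
    then have "eventually (\<lambda>_. False) p" by simp
    then have "\<exists>P Q. eventually P sequentially \<and> eventually Q (filtercomap ev (nhds x))
      \<and> (\<forall>n. P n \<and> Q n \<longrightarrow> False)"
      unfolding p_def eventually_inf .
    then obtain P Q where PQ: "eventually P sequentially" "eventually Q (filtercomap ev (nhds x))"
      "\<And>n. P n \<Longrightarrow> Q n \<Longrightarrow> False"
      by blast
    from PQ(2) obtain R where R: "eventually R (nhds x)" "\<And>n. R (ev n) \<Longrightarrow> Q n"
      by (auto simp: eventually_filtercomap)
    have "eventually (\<lambda>y. \<not> R y) (filtermap ev sequentially)"
      unfolding eventually_filtermap using PQ(1) by eventually_elim (use PQ R in blast)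
    with R(1) have "eventually (\<lambda>_. False) (inf (nhds x) (filtermap ev sequentially))"
      unfolding eventually_inf by (intro exI[of _ R] exI[of _ "\<lambda>y. \<not> R y"]) simp
    then show False using x by (simp add: trivial_limit_def)
  qed
  moreover have "eventually P p \<or> eventually (\<lambda>n. \<not> P n) p" for P
  proof -
    have "open {y. y {n. P n} = x {n. P n}}"
    proof -
      have "continuous_on UNIV (\<lambda>y::nat set \<Rightarrow> bool. y {n. P n})"
        by (rule continuous_on_product_coordinates)
      then have "open ((\<lambda>y::nat set \<Rightarrow> bool. y {n. P n}) -` {x {n. P n}})"
        by (rule open_vimage[rotated]) (simp add: Topological_Spaces.open_discrete)
      then show ?thesis by (simp add: vimage_def)
    qed
    then have "eventually (\<lambda>y. y {n. P n} = x {n. P n}) (nhds x)"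
      by (auto simp: eventually_nhds)
    then have "eventually (\<lambda>n. P n = x {n. P n}) (filtercomap ev (nhds x))"
      unfolding eventually_filtercomap by (rule exI[of _ "\<lambda>y. y {n. P n} = x {n. P n}", OF conjI]) (auto simp: ev_def)
    then have "eventually (\<lambda>n. P n = x {n. P n}) p"
      unfolding p_def by (rule filter_leD[rotated]) simp
    then show ?thesis by (cases "x {n. P n}") auto
  qed
  ultimately show ?thesis unfolding p_def by (intro exI[of _ p]) (auto simp: p_def)
qed

lemma ultrafilter_finite_cases:
  assumes ultra: "\<And>P. eventually P p \<or> eventually (\<lambda>n. \<not> P n) p" and "finite L"
    and "eventually (\<lambda>n. f n \<in> L) p" and "p \<noteq> bot"
  shows "\<exists>l\<in>L. eventually (\<lambda>n. f n = l) p"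
proof (rule ccontr)
  assume "\<not> ?thesis"
  then have "eventually (\<lambda>n. f n \<noteq> l) p" if "l \<in> L" for l
    using ultra that by blast
  then have "eventually (\<lambda>n. \<forall>l\<in>L. f n \<noteq> l) p"
    using \<open>finite L\<close> by (simp add: eventually_ball_finite)
  with assms(3) have "eventually (\<lambda>n. False) p" by eventually_elim auto
  then show False using \<open>p \<noteq> bot\<close> by (simp add: trivial_limit_def)
qed

text \<open>Any finite number of histories can be served at once by one \<open>p\<close>-large set.
  Choosing the next value for all histories with entries up to the last value makes not only
  \<open>e\<close> but each of its subsequences obey \<open>A\<close>.\<close>

lemma diagonal_sequence:
  fixes A :: "nat list \<Rightarrow> nat set"
  assumes p: "p \<noteq> bot" "p \<le> sequentially" and A: "\<And>t. eventually (\<lambda>m. m \<in> A t) p"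
  shows "\<exists>e::nat \<Rightarrow> nat. strict_mono e \<and>
    (\<forall>f n. strict_mono f \<longrightarrow> range f \<subseteq> range e \<longrightarrow> f n \<in> A (map f [0..<n]))"
proof -
  \<comment> \<open>A strictly increasing list with entries at most \<open>b\<close> has at most
    \<open>Suc b\<close> entries, so \<open>T b\<close> contains all histories that can precede a
    value chosen after \<open>b\<close>.\<close>
  define T where "T b = {t :: nat list. set t \<subseteq> {..b} \<and> length t \<le> Suc b}" for b
  have finT: "finite (T b)" for b
    unfolding T_def by (rule finite_lists_length_le) simp
  have ex: "\<exists>m>b. \<forall>t\<in>T b. m \<in> A t" for b
  proof -
    have "eventually (\<lambda>m. \<forall>t\<in>T b. m \<in> A t) p"
      using finT A by (simp add: eventually_ball_finite)
    moreover have "eventually (\<lambda>m. m > b) p"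
      using p(2) eventually_gt_at_top by (rule filter_leD)
    ultimately have "eventually (\<lambda>m. m > b \<and> (\<forall>t\<in>T b. m \<in> A t)) p"
      by eventually_elim auto
    then show ?thesis using p(1) eventually_happens by blast
  qed
  obtain m0 where m0: "m0 \<in> A []"
    using A[of "[]"] p(1) eventually_happens by blast
  obtain nx where nx: "\<And>b. nx b > b" "\<And>b t. t \<in> T b \<Longrightarrow> nx b \<in> A t"
    using ex by metis
  define e where "e = rec_nat m0 (\<lambda>_. nx)"
  have e0: "e 0 = m0" and eS: "\<And>n. e (Suc n) = nx (e n)" by (simp_all add: e_def)
  have mono: "strict_mono e"
    using nx(1) by (simp add: strict_mono_Suc_iff eS)
  have main: "f n \<in> A (map f [0..<n])" if f: "strict_mono f" "range f \<subseteq> range e" for f n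
  proof -
    obtain k where k: "f n = e k" using f(2) by blast
    show ?thesis
    proof (cases k)
      case 0
      have "n = 0"
      proof (rule ccontr)
        assume "n \<noteq> 0"
        then have "f 0 < f n" using f(1) by (simp add: strict_mono_less)
        moreover obtain j where "f 0 = e j" using f(2) by blast
        ultimately show False using mono k 0 by (simp add: strict_mono_less)
      qed
      then show ?thesis using k 0 m0 e0 by simp
    next
      case (Suc j)
      have "f i \<le> e j" if "i < n" for i
      proof -
        obtain q where q: "f i = e q" using f(2) by blast
        have "f i < f n" using f(1) that by (simp add: strict_mono_less)
        then have "q < k" using q k mono by (simp add: strict_mono_less)
        then show ?thesis using q Suc mono by (simp add: strict_mono_less_eq)
      qed
      moreover have "n \<le> Suc (e j)"
      proof -
        have "n \<le> f n" by (rule strict_mono_imp_increasing[OF f(1)])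
        show ?thesis
        proof (cases n)
          case (Suc i)
          then have "i \<le> f i" using strict_mono_imp_increasing[OF f(1)] by simp
          also have "f i \<le> e j" using \<open>\<And>i. i < n \<Longrightarrow> f i \<le> e j\<close> Suc by simp
          finally show ?thesis using Suc by simp
        qed simp
      qed
      ultimately have "map f [0..<n] \<in> T (e j)" by (auto simp: T_def)
      then show ?thesis using nx(2) k Suc eS by simp
    qed
  qed
  show ?thesis by (intro exI[of _ e] conjI allI impI mono main)
qed

text \<open>Serves as the monotonicity rule that lets \<open>accepts\<close> recur under the filter
  quantifier.\<close>

lemma eventually_imp_mono: "(\<And>x. P x \<longrightarrow> Q x) \<Longrightarrow> eventually P p \<longrightarrow> eventually Q p"
  by (auto elim: eventually_mono)

text \<open>Acceptance of \<open>s\<close> is a win in the well-founded game in which \<open>s\<close> is extended by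
  \<open>p\<close>-generic numbers until a member of \<open>\<F>\<close> is reached.\<close>

inductive accepts :: "nat filter \<Rightarrow> nat list set \<Rightarrow> nat list \<Rightarrow> bool" for p \<F> where
  base: "s \<in> \<F> \<Longrightarrow> accepts p \<F> s"
| step: "eventually (\<lambda>m. accepts p \<F> (s @ [m])) p \<Longrightarrow> accepts p \<F> s"
monos eventually_imp_mono

text \<open>Strategies are glued along the well-founded game tree: once the next entry
  \<open>m\<close> is seen, play continues by a strategy for \<open>s\<close> extended by
  \<open>m\<close>.\<close>

lemma accepts_strategy:
  assumes "accepts p \<F> s"
  shows "\<exists>A. (\<forall>t. eventually (\<lambda>m. m \<in> A t) p) \<and>
    (\<forall>f. map f [0..<length s] = s \<longrightarrow> (\<forall>n\<ge>length s. f n \<in> A (map f [0..<n])) \<longrightarrow>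
      (\<exists>n. map f [0..<n] \<in> \<F>))" (is "\<exists>A. ?C s A")
  using assms
proof induction
  case (base s)
  then show ?case by (intro exI[of _ "\<lambda>_. UNIV"] conjI allI impI exI[of _ "length s"]) simp_all
next
  case (step s)
  define B where "B = {m. \<exists>A. ?C (s @ [m]) A}"
  have "\<forall>m\<in>B. \<exists>A. ?C (s @ [m]) A" by (simp add: B_def)
  then obtain A0 where A0: "\<And>m. m \<in> B \<Longrightarrow> ?C (s @ [m]) (A0 m)"
    by (rule bchoice[THEN exE]) blast
  have B: "eventually (\<lambda>m. m \<in> B) p"
    using step by (rule eventually_mono) (simp add: B_def)
  \<comment> \<open>The entry \<open>t ! length s\<close> tells which subgame is being played.
    Histories whose entry lies outside \<open>B\<close> get \<open>UNIV\<close>, which only keeps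
    every \<open>A t\<close> large for \<open>p\<close>.\<close>
  define A where "A t = (if length t \<le> length s then B
    else if t ! length s \<in> B then A0 (t ! length s) t else UNIV)" for t
  have "eventually (\<lambda>m. m \<in> A t) p" for t
    using B A0 by (simp add: A_def)
  moreover have "\<exists>n. map f [0..<n] \<in> \<F>"
    if f: "map f [0..<length s] = s" "\<And>n. n \<ge> length s \<Longrightarrow> f n \<in> A (map f [0..<n])" for f
  proof -
    have m: "f (length s) \<in> B" using f(2)[of "length s"] by (simp add: A_def)
    have "f n \<in> A0 (f (length s)) (map f [0..<n])" if "n \<ge> Suc (length s)" for n
      using f(2)[of n] that m by (simp add: A_def)
    with A0[OF m] f(1) show ?thesis by auto
  qed
  ultimately show ?case by blast
qed

text \<open>Galvin's form of the Nash-Williams theorem. The second alternative is phrased by a strategy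
  \<open>A\<close> rather than an infinite set, so that finitely many families can be treated at once by
  intersecting strategies.\<close>

lemma galvin_dichotomy:
  assumes p: "p \<noteq> bot" "p \<le> sequentially"
    and ultra: "\<And>P. eventually P p \<or> eventually (\<lambda>n. \<not> P n) p"
  shows "(\<exists>e::nat \<Rightarrow> nat. strict_mono e \<and>
      (\<forall>f n. strict_mono f \<longrightarrow> range f \<subseteq> range e \<longrightarrow> map f [0..<n] \<notin> \<F>)) \<or>
    (\<exists>A. (\<forall>t. eventually (\<lambda>m. m \<in> A t) p) \<and>
      (\<forall>f. (\<forall>n. f n \<in> A (map f [0..<n])) \<longrightarrow> (\<exists>n. map f [0..<n] \<in> \<F>)))"
proof (cases "accepts p \<F> []")
  case True
  from accepts_strategy[OF this] show ?thesis by auto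
next
  case False
  \<comment> \<open>If \<open>t\<close> is not accepted, then by the ultrafilter property
    \<open>p\<close>-almost no extension by one entry is accepted. Hence rejection of the empty list
    propagates to all prefixes of subsequences of \<open>e\<close>.\<close>
  define A where "A t = {m. accepts p \<F> (t @ [m]) \<longrightarrow> accepts p \<F> t}" for t
  have A: "eventually (\<lambda>m. m \<in> A t) p" for t
    using ultra[of "\<lambda>m. accepts p \<F> (t @ [m])"]
  proof
    assume "eventually (\<lambda>m. accepts p \<F> (t @ [m])) p"
    then have "accepts p \<F> t" by (rule accepts.step)
    then show ?thesis by (simp add: A_def)
  next
    assume "eventually (\<lambda>m. \<not> accepts p \<F> (t @ [m])) p"
    then show ?thesis by (rule eventually_mono) (simp add: A_def)
  qed
  from diagonal_sequence[of p A, OF p A] obtain e :: "nat \<Rightarrow> nat" where e: "strict_mono e"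
    "\<forall>f n. strict_mono f \<longrightarrow> range f \<subseteq> range e \<longrightarrow> f n \<in> A (map f [0..<n])"
    by (elim exE conjE)
  have main: "map f [0..<n] \<notin> \<F>" if f: "strict_mono f" "range f \<subseteq> range e" for f n
  proof -
    have "\<not> accepts p \<F> (map f [0..<n])"
      by (induction n) (use False e(2)[rule_format, OF f] in \<open>auto simp: A_def\<close>)
    then show ?thesis using accepts.base by blast
  qed
  show ?thesis by (intro disjI1 exI[of _ e] conjI allI impI e(1) main)
qed

lemma pigeonhole_fibre:
  assumes "\<And>j. j < N \<Longrightarrow> \<theta> j < k" and "(K - 1) * k < N"
  shows "\<exists>l<k. \<exists>S\<subseteq>{..<N}. card S = K \<and> (\<forall>j\<in>S. \<theta> j = (l::nat))"
proof -
  have "\<exists>l<k. K \<le> card {j. j < N \<and> \<theta> j = l}"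
  proof (rule ccontr)
    assume "\<not> ?thesis"
    then have less: "card {j. j < N \<and> \<theta> j = l} \<le> K - 1" if "l < k" for l
      using that by fastforce
    have "{..<N} = (\<Union>l<k. {j. j < N \<and> \<theta> j = l})" using assms(1) by auto
    then have "N \<le> (\<Sum>l<k. card {j. j < N \<and> \<theta> j = l})"
      by (metis card_UN_le card_lessThan finite_lessThan)
    also have "\<dots> \<le> (\<Sum>l<k. K - 1)" by (intro sum_mono less) simp
    finally show False using assms(2) by (simp add: mult.commute)
  qed
  then obtain l where l: "l < k" "K \<le> card {j. j < N \<and> \<theta> j = l}" by blast
  obtain S where "S \<subseteq> {j. j < N \<and> \<theta> j = l}" "card S = K"
    using obtain_subset_with_card_n[OF l(2)] by metis
  with l(1) show ?thesis by (intro exI[of _ l] conjI exI[of _ S]) auto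
qed

text \<open>Block \<open>q\<close> of length \<open>N\<close> is placed so that its entry with
  residue \<open>s q\<close> lands on \<open>N * Suc (2 * q)\<close>, whatever \<open>s q\<close>
  is. The spacing \<open>2 * N\<close> keeps consecutive blocks from overlapping.\<close>

lemma strict_mono_block_shift:
  assumes "\<And>q. s q < (N::nat)"
  shows "strict_mono (\<lambda>r. r + N * Suc (r div N) - s (r div N))"
  unfolding strict_mono_Suc_iff
proof
  fix r
  have "s (r div N) < N" "s (Suc r div N) < N" using assms by auto
  then show "r + N * Suc (r div N) - s (r div N) < Suc r + N * Suc (Suc r div N) - s (Suc r div N)"
    by (cases "Suc r mod N = 0") (simp_all add: div_Suc)
qed

text \<open>\<open>P A\<close> says that one point realises the partial pattern \<open>A\<close> of pairs (position, symbol).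
  For each assignment \<open>\<theta>\<close> of a colour to every symbol one plays Galvin's dichotomy for the
  increasing sequences along which the cyclic word \<open>0, 1, \<dots>, N - 1, 0, \<dots>\<close> fails to split
  according to \<open>\<theta>\<close>. The splittings of one long cyclic word select a \<open>\<theta>\<close> for which the
  strategic alternative is impossible; a popular colour of \<open>\<theta>\<close> then yields \<open>S\<close>, and arbitrary
  words over \<open>S\<close> embed in the cyclic word because the remaining positions are free.\<close>

lemma uniform_pattern_extraction:
  fixes P :: "(nat \<times> nat) set \<Rightarrow> bool"
  assumes hered: "\<And>A B. P A \<Longrightarrow> B \<subseteq> A \<Longrightarrow> P B"
    and split: "\<And>n \<tau>. (\<And>i. \<tau> i < N) \<Longrightarrow>
      \<exists>c. (\<forall>i. c i < k) \<and> (\<forall>l<k. P ((\<lambda>i. (i, \<tau> i)) ` {i. i < n \<and> c i = l}))"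
    and N: "(K - 1) * k < N" and K: "0 < K"
  shows "\<exists>S J. S \<subseteq> {..<N} \<and> card S = K \<and> infinite J \<and>
    (\<forall>I \<sigma>. finite I \<longrightarrow> I \<subseteq> J \<longrightarrow> (\<forall>i\<in>I. \<sigma> i \<in> S) \<longrightarrow> P ((\<lambda>i. (i, \<sigma> i)) ` I))"
proof -
  obtain p :: "nat filter" where p: "p \<noteq> bot" "p \<le> sequentially"
    and ultra: "\<And>Q. eventually Q p \<or> eventually (\<lambda>n. \<not> Q n) p"
    using free_ultrafilter_exists by blast
  have p_gt: "eventually (\<lambda>m. m > b) p" for b
    using p(2) eventually_gt_at_top by (rule filter_leD)
  define L where "L = ({..<N} \<rightarrow>\<^sub>E {..<k})"
  have "finite L" unfolding L_def by (intro finite_PiE) auto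
  have N0: "N > 0" using N by simp
  define F where "F \<theta> = {t. \<exists>l<k. \<not> P ((\<lambda>r. (t ! r, r mod N)) ` {r. r < length t \<and> \<theta> (r mod N) = l})}"
    for \<theta> :: "nat \<Rightarrow> nat"
  show ?thesis
  proof (cases "\<exists>\<theta>\<in>L. \<exists>e::nat \<Rightarrow> nat. strict_mono e \<and>
      (\<forall>f n. strict_mono f \<longrightarrow> range f \<subseteq> range e \<longrightarrow> map f [0..<n] \<notin> F \<theta>)")
    case True
    then obtain \<theta> and e :: "nat \<Rightarrow> nat" where \<theta>: "\<theta> \<in> L" and e: "strict_mono e"
      and good: "\<And>f n. strict_mono f \<Longrightarrow> range f \<subseteq> range e \<Longrightarrow> map f [0..<n] \<notin> F \<theta>"
      by (elim bexE exE conjE) simp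
    have "\<theta> j < k" if "j < N" for j using \<theta> that by (auto simp: L_def)
    from pigeonhole_fibre[of N \<theta> k K, OF this N] obtain l S
      where l: "l < k" and S: "S \<subseteq> {..<N}" "card S = K" "\<And>j. j \<in> S \<Longrightarrow> \<theta> j = l" by blast
    obtain s0 where s0: "s0 \<in> S" using S(2) K by fastforce
    define pos where "pos q = e (N * Suc (2 * q))" for q
    have "inj pos"
      unfolding pos_def using N0 e by (intro injI) (simp add: strict_mono_eq)
    then have "infinite (range pos)" by (simp add: finite_image_iff)
    moreover have "P ((\<lambda>i. (i, \<sigma> i)) ` I)"
      if I: "finite I" "I \<subseteq> range pos" "\<forall>i\<in>I. \<sigma> i \<in> S" for I \<sigma>
    proof -
      \<comment> \<open>Block \<open>q\<close> is shifted so that the symbol wanted at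
        \<open>pos q\<close> falls exactly there. Blocks without a demand receive \<open>s0\<close>,
        an arbitrary element of \<open>S\<close>.\<close>
      define s where "s q = (if pos q \<in> I then \<sigma> (pos q) else s0)" for q
      have sS: "s q \<in> S" for q using I s0 by (simp add: s_def)
      then have sN: "s q < N" for q using S(1) by auto
      define f where "f = e \<circ> (\<lambda>r. r + N * Suc (r div N) - s (r div N))"
      have f: "strict_mono f" "range f \<subseteq> range e"
        unfolding f_def using strict_mono_block_shift[of s N, OF sN] e
        by (auto intro: strict_mono_o)
      obtain Q where Q: "I \<subseteq> pos ` {..<Q}"
      proof -
        obtain B where B: "finite B" "I = pos ` B" using I(1,2) by (meson finite_subset_image)
        then obtain Q where "B \<subseteq> {..<Q}" using finite_nat_iff_bounded by blast
        with B that show ?thesis by blast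
      qed
      have "P ((\<lambda>r. (map f [0..<N * Q] ! r, r mod N)) ` {r. r < N * Q \<and> \<theta> (r mod N) = l})"
        using good[OF f, of "N * Q"] l by (auto simp: F_def)
      moreover have "(\<lambda>i. (i, \<sigma> i)) ` I \<subseteq>
        (\<lambda>r. (map f [0..<N * Q] ! r, r mod N)) ` {r. r < N * Q \<and> \<theta> (r mod N) = l}"
      proof
        fix z assume "z \<in> (\<lambda>i. (i, \<sigma> i)) ` I"
        then obtain q where q: "q < Q" "pos q \<in> I" "z = (pos q, \<sigma> (pos q))" using Q by auto
        define r where "r = N * q + s q"
        have r: "r div N = q" "r mod N = s q" using sN[of q] by (simp_all add: r_def)
        have "r < N * Suc q" using sN[of q] by (simp add: r_def)
        also have "N * Suc q \<le> N * Q" using q(1) by (intro mult_le_mono2) simp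
        finally have "r < N * Q" .
        moreover have "f r = pos q"
          unfolding f_def comp_def r pos_def using sN[of q]
          by (intro arg_cong[of _ _ e]) (simp add: r_def algebra_simps)
        moreover have "s q = \<sigma> (pos q)" using q by (simp add: s_def)
        ultimately show "z \<in> (\<lambda>r. (map f [0..<N * Q] ! r, r mod N)) ` {r. r < N * Q \<and> \<theta> (r mod N) = l}"
          using q(3) r sS[of q] S(3) by (intro image_eqI[of _ _ r]) auto
      qed
      ultimately show ?thesis by (rule hered)
    qed
    ultimately show ?thesis using S(1,2) by (intro exI[of _ S] exI[of _ "range pos"]) auto
  next
    case False
    have "\<forall>\<theta>\<in>L. \<exists>A. (\<forall>t. eventually (\<lambda>m. m \<in> A t) p) \<and>
      (\<forall>f. (\<forall>n. f n \<in> A (map f [0..<n])) \<longrightarrow> (\<exists>n. map f [0..<n] \<in> F \<theta>))"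
    proof (rule ballI)
      fix \<theta> assume "\<theta> \<in> L"
      have neg: "\<not> (\<exists>e::nat \<Rightarrow> nat. strict_mono e \<and>
        (\<forall>f n. strict_mono f \<longrightarrow> range f \<subseteq> range e \<longrightarrow> map f [0..<n] \<notin> F \<theta>))"
        by (rule notI) (rule False[THEN notE], rule bexI[OF _ \<open>\<theta> \<in> L\<close>])
      show "\<exists>A. (\<forall>t. eventually (\<lambda>m. m \<in> A t) p) \<and>
        (\<forall>f. (\<forall>n. f n \<in> A (map f [0..<n])) \<longrightarrow> (\<exists>n. map f [0..<n] \<in> F \<theta>))"
        by (rule disjE[OF galvin_dichotomy[OF p ultra, of "F \<theta>"]]) (rule notE[OF neg], assumption)
    qed
    then obtain A where A: "\<forall>\<theta>\<in>L. (\<forall>t. eventually (\<lambda>m. m \<in> A \<theta> t) p) \<and>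
      (\<forall>f. (\<forall>n. f n \<in> A \<theta> (map f [0..<n])) \<longrightarrow> (\<exists>n. map f [0..<n] \<in> F \<theta>))"
      by (rule bchoice[THEN exE])
    have "eventually (\<lambda>m. m \<in> (\<Inter>\<theta>\<in>L. A \<theta> t)) p" for t
      using \<open>finite L\<close> A by (simp add: eventually_ball_finite)
    from diagonal_sequence[of p "\<lambda>t. \<Inter>\<theta>\<in>L. A \<theta> t", OF p this]
    obtain e :: "nat \<Rightarrow> nat" where e: "strict_mono e"
      and eA: "\<forall>f n. strict_mono f \<longrightarrow> range f \<subseteq> range e \<longrightarrow> f n \<in> (\<Inter>\<theta>\<in>L. A \<theta> (map f [0..<n]))"
      by (elim exE conjE)
    \<comment> \<open>The cyclic word is written along \<open>range e\<close>. Off this range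
      \<open>inv e\<close> is arbitrary, and the remainder keeps its value a legal symbol.\<close>
    define \<tau> where "\<tau> i = inv e i mod N" for i
    have "\<tau> i < N" for i using N0 by (simp add: \<tau>_def)
    then have "\<exists>c. (\<forall>i. c i < k) \<and> (\<forall>l<k. P ((\<lambda>i. (i, \<tau> i)) ` {i. i < n \<and> c i = l}))" for n
      by (rule split)
    then obtain c where c: "\<And>n i. c n i < k"
      "\<And>n l. l < k \<Longrightarrow> P ((\<lambda>i. (i, \<tau> i)) ` {i. i < n \<and> c n i = l})" by metis
    \<comment> \<open>Two limits along \<open>p\<close> follow: \<open>d\<close> is the limit of the
      splittings \<open>c n\<close> of longer and longer prefixes, and \<open>\<mu> j\<close> is the
      limit of the colours \<open>d\<close> at positions carrying the symbol
      \<open>j\<close>.\<close>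
    have "\<exists>l\<in>{..<k}. eventually (\<lambda>n. c n i = l) p" for i
      using ultra p(1) c(1) by (intro ultrafilter_finite_cases) auto
    then obtain d where d: "\<And>i. d i < k" "\<And>i. eventually (\<lambda>n. c n i = d i) p"
      by (metis lessThan_iff)
    have "\<exists>l\<in>{..<k}. eventually (\<lambda>q. d (e (q * N + j)) = l) p" for j
      using ultra p(1) d(1) by (intro ultrafilter_finite_cases) auto
    then obtain \<mu> where \<mu>: "\<And>j. \<mu> j < k" "\<And>j. eventually (\<lambda>q. d (e (q * N + j)) = \<mu> j) p"
      by (metis lessThan_iff)
    define \<theta> where "\<theta> = restrict \<mu> {..<N}"
    have \<theta>: "\<theta> \<in> L" using \<mu>(1) by (auto simp: \<theta>_def L_def)
    define Q where "Q = {q. \<forall>j<N. d (e (q * N + j)) = \<mu> j}"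
    have evQ: "eventually (\<lambda>q. q \<in> Q) p"
      using eventually_ball_finite[of "{..<N}" "\<lambda>q j. d (e (q * N + j)) = \<mu> j" p] \<mu>(2)
      by (simp add: Q_def Ball_def)
    have "infinite Q"
    proof
      assume "finite Q"
      then obtain b where "\<And>q. q \<in> Q \<Longrightarrow> q < b" using finite_nat_iff_bounded by auto
      then have "eventually (\<lambda>q. False) p"
        using eventually_conj[OF evQ p_gt[of b]] by (elim eventually_mono) (meson less_asym)
      then show False using p(1) by (simp add: trivial_limit_def)
    qed
    \<comment> \<open>Only blocks on which all \<open>N\<close> colours agree with
      \<open>\<mu>\<close> are kept, and they are kept whole, so the \<open>r\<close>-th entry still
      carries the symbol \<open>r mod N\<close>. As a subsequence of \<open>e\<close>,
      \<open>f\<close> obeys \<open>A \<theta>\<close> and must run into a failure, which the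
      splitting \<open>c m\<close> for a late \<open>m\<close> refutes.\<close>
    define f where "f r = e (enumerate Q (r div N) * N + r mod N)" for r
    have "strict_mono (\<lambda>r. enumerate Q (r div N) * N + r mod N)"
      unfolding strict_mono_Suc_iff
    proof
      fix r
      have "enumerate Q (r div N) * N + N \<le> enumerate Q (Suc (r div N)) * N"
        using enumerate_step[OF \<open>infinite Q\<close>, of "r div N"]
        by (metis Suc_leI mult_Suc mult_le_mono1 add.commute)
      moreover have "r mod N < N" using N0 by simp
      ultimately show "enumerate Q (r div N) * N + r mod N < enumerate Q (Suc r div N) * N + Suc r mod N"
        by (auto simp: div_Suc mod_Suc)
    qed
    then have f: "strict_mono f" "range f \<subseteq> range e"
      unfolding f_def using e by (auto simp: strict_mono_def)
    have "\<forall>n. f n \<in> A \<theta> (map f [0..<n])" using eA f \<theta> by blast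
    then obtain n where "map f [0..<n] \<in> F \<theta>" using A \<theta> by blast
    then obtain l where l: "l < k"
      "\<not> P ((\<lambda>r. (map f [0..<n] ! r, r mod N)) ` {r. r < n \<and> \<theta> (r mod N) = l})"
      by (auto simp: F_def)
    have "eventually (\<lambda>m. m > f n \<and> (\<forall>r\<in>{..<n}. c m (f r) = d (f r))) p"
      using p_gt d(2) by (simp add: eventually_ball_finite eventually_conj)
    then obtain m where m: "m > f n" "\<And>r. r < n \<Longrightarrow> c m (f r) = d (f r)"
      using eventually_happens'[OF p(1)] by fastforce
    have "(\<lambda>r. (map f [0..<n] ! r, r mod N)) ` {r. r < n \<and> \<theta> (r mod N) = l}
      \<subseteq> (\<lambda>i. (i, \<tau> i)) ` {i. i < m \<and> c m i = l}"
    proof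
      fix z assume "z \<in> (\<lambda>r. (map f [0..<n] ! r, r mod N)) ` {r. r < n \<and> \<theta> (r mod N) = l}"
      then obtain r where r: "r < n" "\<theta> (r mod N) = l" "z = (f r, r mod N)" by auto
      have "f r < m" using m(1) r(1) f(1) by (meson less_trans strict_monoD)
      moreover have "d (f r) = \<mu> (r mod N)"
        using enumerate_in_set[OF \<open>infinite Q\<close>, of "r div N"] N0 by (simp add: f_def Q_def)
      then have "c m (f r) = l" using m(2) r N0 by (simp add: \<theta>_def)
      moreover have "\<tau> (f r) = r mod N"
        using strict_mono_imp_inj_on[OF e] by (simp add: \<tau>_def f_def inv_f_f)
      ultimately show "z \<in> (\<lambda>i. (i, \<tau> i)) ` {i. i < m \<and> c m i = l}"
        using r(3) by (intro image_eqI[of _ _ "f r"]) auto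
    qed
    with c(2)[OF l(1)] l(2) hered show ?thesis by blast
  qed
qed

section \<open>Averages over the acting group\<close>

text \<open>Lists count multiplicities, so that an average over all sums \<open>g + h\<close> is
  exactly an iterated average even when sums coincide.\<close>

definition list_avg :: "'a list \<Rightarrow> ('a \<Rightarrow> real) \<Rightarrow> real" where
  "list_avg L f = sum_list (map f L) / real (length L)"

lemma list_avg_mono: "(\<And>x. x \<in> set L \<Longrightarrow> f x \<le> g x) \<Longrightarrow> list_avg L f \<le> list_avg L g"
  unfolding list_avg_def by (intro divide_right_mono sum_list_mono) auto

lemma list_avg_const: "L \<noteq> [] \<Longrightarrow> list_avg L (\<lambda>_. c) = c"
  by (simp add: list_avg_def sum_list_triv)

lemma list_avg_le: "L \<noteq> [] \<Longrightarrow> (\<And>x. x \<in> set L \<Longrightarrow> f x \<le> c) \<Longrightarrow> list_avg L f \<le> c"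
  using list_avg_mono[of L f "\<lambda>_. c"] by (simp add: list_avg_const)

lemma list_avg_ge: "L \<noteq> [] \<Longrightarrow> (\<And>x. x \<in> set L \<Longrightarrow> c \<le> f x) \<Longrightarrow> c \<le> list_avg L f"
  using list_avg_mono[of L "\<lambda>_. c" f] by (simp add: list_avg_const)

lemma list_avg_diff: "list_avg L (\<lambda>x. f x - g x) = list_avg L f - list_avg L g"
  by (simp add: list_avg_def sum_list_subtractf diff_divide_distrib)

lemma list_avg_add: "list_avg L (\<lambda>x. f x + g x) = list_avg L f + list_avg L g"
  by (simp add: list_avg_def sum_list_addf add_divide_distrib)

lemma list_avg_sum: "finite A \<Longrightarrow> list_avg L (\<lambda>x. \<Sum>i\<in>A. f i x) = (\<Sum>i\<in>A. list_avg L (f i))"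
  by (induction A rule: finite_induct) (simp_all add: list_avg_add, simp add: list_avg_def sum_list_triv)

lemma list_avg_abs_diff_le:
  assumes "L \<noteq> []" "\<And>x. x \<in> set L \<Longrightarrow> \<bar>f x - c\<bar> \<le> e"
  shows "\<bar>list_avg L f - c\<bar> \<le> e"
  using list_avg_le[OF assms(1), of f "c + e"] list_avg_ge[OF assms(1), of "c - e" f] assms(2)
  by (simp add: abs_le_iff) (smt (verit))

definition prod_list_add :: "'g::plus list \<Rightarrow> 'g list \<Rightarrow> 'g list" where
  "prod_list_add L M = concat (map (\<lambda>h. map (\<lambda>g. g + h) L) M)"

lemma prod_list_add_Nil_iff: "prod_list_add L M = [] \<longleftrightarrow> L = [] \<or> M = []"
  by (cases M) (auto simp: prod_list_add_def)

lemma list_avg_prod_list_add: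
  "list_avg (prod_list_add L M) f = list_avg M (\<lambda>h. list_avg L (\<lambda>g. f (g + h)))"
proof -
  have "length (prod_list_add L M) = length M * length L"
    by (induction M) (auto simp: prod_list_add_def)
  moreover have "sum_list (map f (prod_list_add L M)) = sum_list (map (\<lambda>h. sum_list (map (\<lambda>g. f (g + h)) L)) M)"
    by (induction M) (auto simp: prod_list_add_def comp_def)
  moreover have "sum_list (map (\<lambda>h. u h / c) M) = sum_list (map u M) / c" for u :: "'a \<Rightarrow> real" and c
    by (induction M) (auto simp: add_divide_distrib)
  ultimately show ?thesis by (simp add: list_avg_def)
qed

section \<open>Uniform averages on a minimal equicontinuous system\<close>

locale equicontinuous_minimal =
  fixes a :: "'g::group_add \<Rightarrow> 'h::metric_space \<Rightarrow> 'h" and \<nu> :: "'h measure"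
  assumes compact_H: "compact (UNIV :: 'h set)"
    and G_system: "G_system a"
    and equicontinuous: "equicontinuous_on UNIV a"
    and minimal: "minimal_system a"
    and haar: "haar_measure a \<nu>"
begin

sublocale prob_space \<nu> using haar by (simp add: haar_measure_def)

lemma sets_nu: "sets \<nu> = sets borel" using haar by (simp add: haar_measure_def)

lemma space_nu: "space \<nu> = UNIV" using sets_eq_imp_space_eq[OF sets_nu] by simp

lemma act_zero: "a 0 x = x" and act_add: "a (g + h) x = a g (a h x)"
  and act_cont: "continuous_on UNIV (a g)"
  using G_system by (auto simp: G_system_def)

lemma act_uminus: "a (- g) (a g x) = x" "a g (a (- g) x) = x"
  by (simp_all add: act_add[symmetric] act_zero)

lemma equicontinuousE:
  assumes "e > 0"
  obtains d where "d > 0" "\<And>g x y. dist x y < d \<Longrightarrow> dist (a g x) (a g y) < e"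
  using equicontinuous assms unfolding equicontinuous_on_def by (metis UNIV_I)

text \<open>Compactness is applied to the square of \<open>H\<close>, which makes one finite list
  serve all pairs of points; minimality says that the sets \<open>U g\<close> cover the
  square.\<close>

lemma finite_transitive_net:
  assumes "d > 0"
  obtains L where "L \<noteq> []" "\<And>x y. \<exists>g\<in>set L. dist (a g x) y < d"
proof -
  define U where "U g = {z. dist (a g (fst z)) (snd z) < d}" for g
  have op: "open (U g)" for g
  proof -
    have "continuous_on UNIV (\<lambda>z. dist (a g (fst z)) (snd z))"
      by (intro continuous_on_dist continuous_on_snd continuous_on_id
          continuous_on_compose2[OF act_cont[of g] continuous_on_fst[OF continuous_on_id]]) auto
    then have "open ((\<lambda>z. dist (a g (fst z)) (snd z)) -` {..<d})"
      by (intro open_vimage) auto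
    then show ?thesis by (simp add: U_def vimage_def)
  qed
  have cov: "(x, y) \<in> (\<Union>g. U g)" for x y
  proof -
    have "y \<in> closure (range (\<lambda>g. a g x))" using minimal by (simp add: minimal_system_def)
    then show ?thesis using assms by (auto simp: closure_approachable U_def)
  qed
  have "compact (UNIV \<times> UNIV :: ('h \<times> 'h) set)" using compact_H by (intro compact_Times)
  then obtain F where F: "finite F" "(UNIV \<times> UNIV) \<subseteq> (\<Union>g\<in>F. U g)"
    using cov op by (elim compactE_image[of _ UNIV U]) auto
  then obtain L where L: "set L = F" using finite_list by blast
  have net: "\<exists>g\<in>set L. dist (a g x) y < d" for x y
  proof -
    have "(x, y) \<in> (\<Union>g\<in>F. U g)" using F(2) by blast
    then show ?thesis using L by (auto simp: U_def)
  qed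
  then have "L \<noteq> []" by fastforce
  with net that show ?thesis by blast
qed

lemma cont_integrable:
  assumes "continuous_on UNIV (f :: 'h \<Rightarrow> real)"
  shows "integrable \<nu> f"
proof -
  have "compact (range f)" using compact_continuous_image[OF assms compact_H] .
  then obtain B where "\<forall>x\<in>range f. norm x \<le> B" using bounded_iff compact_imp_bounded by blast
  moreover have "f \<in> borel_measurable \<nu>"
    using borel_measurable_continuous_onI[OF assms] measurable_cong_sets[OF sets_nu refl] by blast
  ultimately show ?thesis by (intro integrable_const_bound[of _ B]) auto
qed

lemma integral_act:
  assumes "continuous_on UNIV (f :: 'h \<Rightarrow> real)"
  shows "(\<integral>x. f (a g x) \<partial>\<nu>) = (\<integral>x. f x \<partial>\<nu>)"
proof -
  have m: "a g \<in> measurable \<nu> \<nu>"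
    using borel_measurable_continuous_onI[OF act_cont[of g]] measurable_cong_sets[OF sets_nu sets_nu] by blast
  have "distr \<nu> \<nu> (a g) = \<nu>"
    using haar by (intro measure_eqI) (auto simp: emeasure_distr m sets_nu space_nu haar_measure_def)
  moreover have "f \<in> borel_measurable \<nu>" using cont_integrable[OF assms] by auto
  ultimately show ?thesis using integral_distr[OF m, of f] by simp
qed

lemma cont_list_avg:
  assumes "continuous_on UNIV (f :: 'h \<Rightarrow> real)"
  shows "continuous_on UNIV (\<lambda>x. list_avg L (\<lambda>g. f (a g x)))"
proof -
  have "continuous_on UNIV (\<lambda>x. sum_list (map (\<lambda>g. f (a g x)) L))"
    by (induction L) (auto intro!: continuous_intros continuous_on_compose2[OF assms act_cont])
  then show ?thesis unfolding list_avg_def by (auto simp: divide_inverse intro!: continuous_intros)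
qed

lemma integral_list_avg:
  assumes f: "continuous_on UNIV (f :: 'h \<Rightarrow> real)" and "L \<noteq> []"
  shows "(\<integral>x. list_avg L (\<lambda>g. f (a g x)) \<partial>\<nu>) = (\<integral>x. f x \<partial>\<nu>)"
proof -
  have c: "continuous_on UNIV (\<lambda>x. f (a g x))" for g
    by (rule continuous_on_compose2[OF f act_cont]) simp
  have "integrable \<nu> (\<lambda>x. sum_list (map (\<lambda>g. f (a g x)) L)) \<and>
    (\<integral>x. sum_list (map (\<lambda>g. f (a g x)) L) \<partial>\<nu>) = real (length L) * (\<integral>x. f x \<partial>\<nu>)"
    by (induction L) (auto simp: cont_integrable[OF c] integral_act[OF f] algebra_simps)
  then show ?thesis using assms(2) by (simp add: list_avg_def)
qed

lemma uniform_modulus: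
  assumes f: "continuous_on UNIV (f :: 'h \<Rightarrow> real)" and "e > 0"
  obtains d where "d > 0" "\<And>g x y. dist x y < d \<Longrightarrow> \<bar>f (a g x) - f (a g y)\<bar> < e"
proof -
  have "uniformly_continuous_on UNIV f" using compact_uniformly_continuous[OF f compact_H] .
  then obtain d1 where "d1 > 0" "\<And>x y. dist x y < d1 \<Longrightarrow> dist (f x) (f y) < e"
    using \<open>e > 0\<close> unfolding uniformly_continuous_on_def by (metis UNIV_I dist_commute)
  moreover obtain d where "d > 0" "\<And>g x y. dist x y < d \<Longrightarrow> dist (a g x) (a g y) < d1"
    using equicontinuousE[OF \<open>d1 > 0\<close>] by blast
  ultimately show ?thesis using that by (metis dist_real_def)
qed

text \<open>Von Neumann's argument: an average whose maximum is nearly minimal has small oscillation,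
  since otherwise averaging once more over a finite transitive net lowers the maximum by a
  definite amount. This replaces Haar measure on the closure of the acting group.\<close>

lemma list_avg_near_integral:
  assumes f: "continuous_on UNIV (f :: 'h \<Rightarrow> real)" and e: "e > 0"
  shows "\<exists>L. L \<noteq> [] \<and> (\<forall>x. \<bar>list_avg L (\<lambda>g. f (a g x)) - (\<integral>x. f x \<partial>\<nu>)\<bar> \<le> e)"
proof -
  define \<Phi> where "\<Phi> L x = list_avg L (\<lambda>g. f (a g x))" for L x
  define M where "M L = Sup (range (\<Phi> L))" for L
  have "compact (range f)" using compact_continuous_image[OF f compact_H] .
  then obtain B where "\<forall>x\<in>range f. norm x \<le> B" using bounded_iff compact_imp_bounded by blast
  then have B: "- B \<le> f x" "f x \<le> B" for x by (auto simp: abs_le_iff minus_le_iff)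
  have \<Phi>B: "- B \<le> \<Phi> L x" "\<Phi> L x \<le> B" if "L \<noteq> []" for L x
    unfolding \<Phi>_def using B that by (auto intro: list_avg_ge list_avg_le)
  have le_M: "\<Phi> L x \<le> M L" if "L \<noteq> []" for L x
    unfolding M_def using \<Phi>B(2)[OF that] by (intro cSup_upper bdd_aboveI2) auto
  have M_le: "M L \<le> c" if "\<And>x. \<Phi> L x \<le> c" for L c
    unfolding M_def using that by (intro cSup_least) auto
  define s where "s = (INF L\<in>{L. L \<noteq> []}. M L)"
  have bdd: "bdd_below (M ` {L. L \<noteq> []})"
    using \<Phi>B(1) le_M order_trans by (intro bdd_belowI2[of _ "- B"]) blast
  have s_le: "s \<le> M L" if "L \<noteq> []" for L
    unfolding s_def using that bdd by (intro cINF_lower) auto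
  obtain d where d: "d > 0" "\<And>g x y. dist x y < d \<Longrightarrow> \<bar>f (a g x) - f (a g y)\<bar> < e / 2"
    using uniform_modulus[OF f, of "e / 2"] e by auto
  obtain F where F: "F \<noteq> []" "\<And>x y. \<exists>g\<in>set F. dist (a g x) y < d"
    using finite_transitive_net[OF d(1)] by blast
  \<comment> \<open>Some translate of \<open>y\<close> by a member of \<open>F\<close> comes close
    to the low point \<open>x\<close>, where the average stays at least \<open>e / 2\<close> below
    its maximum. This one term out of \<open>length F\<close> lowers the new average by at least
    \<open>\<eta>\<close>.\<close>
  define \<eta> where "\<eta> = e / 2 / real (length F)"
  have \<eta>: "\<eta> > 0" using e F by (simp add: \<eta>_def)
  have "\<exists>L\<in>{L. L \<noteq> []}. M L < s + \<eta>"
    using \<eta> bdd unfolding s_def by (subst cINF_less_iff[symmetric]) auto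
  then obtain L where L: "L \<noteq> []" "M L < s + \<eta>" by blast
  have low: "M L - e \<le> \<Phi> L x" for x
  proof (rule ccontr)
    assume "\<not> ?thesis"
    then have x: "\<Phi> L x < M L - e" by simp
    have near: "\<Phi> L y \<le> M L - e / 2" if "dist y x < d" for y
    proof -
      have "\<Phi> L y - \<Phi> L x = list_avg L (\<lambda>g. f (a g y) - f (a g x))"
        by (simp add: \<Phi>_def list_avg_diff)
      also have "\<dots> \<le> e / 2"
        using d(2)[OF that] L(1) by (intro list_avg_le less_imp_le[OF abs_less_iff[THEN iffD1, THEN conjunct1]]) auto
      finally show ?thesis using x by simp
    qed
    have "\<Phi> (prod_list_add L F) y \<le> M L - \<eta>" for y
    proof -
      obtain h0 where h0: "h0 \<in> set F" "dist (a h0 y) x < d" using F(2) by blast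
      obtain F1 F2 where F12: "F = F1 @ h0 # F2" using h0(1) by (meson split_list)
      let ?u = "\<lambda>h. M L - \<Phi> L (a h y)"
      have "e / 2 \<le> ?u h0" using near[OF h0(2)] by simp
      also have "\<dots> \<le> sum_list (map ?u F)"
        unfolding F12 using le_M[OF L(1)] by (auto intro!: add_nonneg_nonneg sum_list_nonneg)
      finally have "\<eta> \<le> list_avg F ?u"
        unfolding \<eta>_def list_avg_def by (intro divide_right_mono) auto
      also have "\<dots> = M L - \<Phi> (prod_list_add L F) y"
        by (simp add: \<Phi>_def list_avg_prod_list_add act_add list_avg_diff list_avg_const F(1))
      finally show ?thesis by simp
    qed
    then have "M (prod_list_add L F) \<le> M L - \<eta>" by (rule M_le)
    moreover have "s \<le> M (prod_list_add L F)"
      using L(1) F(1) by (intro s_le) (simp add: prod_list_add_Nil_iff)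
    ultimately show False using L(2) by simp
  qed
  have int: "integrable \<nu> (\<Phi> L)"
    unfolding \<Phi>_def by (intro cont_integrable cont_list_avg f)
  have I: "(\<integral>x. f x \<partial>\<nu>) = (\<integral>x. \<Phi> L x \<partial>\<nu>)"
    unfolding \<Phi>_def using integral_list_avg[OF f L(1)] by simp
  have "M L - e \<le> (\<integral>x. f x \<partial>\<nu>)" "(\<integral>x. f x \<partial>\<nu>) \<le> M L"
    unfolding I using integral_ge_const[OF int] integral_le_const[OF int] low le_M[OF L(1)] by auto
  then have "\<bar>\<Phi> L x - (\<integral>x. f x \<partial>\<nu>)\<bar> \<le> e" for x
    using low[of x] le_M[OF L(1), of x] by linarith
  then show ?thesis using L(1) unfolding \<Phi>_def by blast
qed

text \<open>Averaging once more cannot spoil an average that is already uniformly close to a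
  constant. The average of the new function over \<open>L\<close> is continuous with the same
  integral, so a second list \<open>F\<close> chosen for it repairs the new function and keeps the
  old ones.\<close>

lemma list_avg_near_integral_finite:
  assumes "finite A" and f: "\<And>i. i \<in> A \<Longrightarrow> continuous_on UNIV (f i :: 'h \<Rightarrow> real)" and e: "e > 0"
  shows "\<exists>L. L \<noteq> [] \<and> (\<forall>i\<in>A. \<forall>x. \<bar>list_avg L (\<lambda>g. f i (a g x)) - (\<integral>x. f i x \<partial>\<nu>)\<bar> \<le> e)"
  using assms(1) f
proof (induction A)
  case empty
  show ?case by (intro exI[of _ "[0]"]) simp
next
  case (insert i A)
  then obtain L where L: "L \<noteq> []"
    "\<And>j x. j \<in> A \<Longrightarrow> \<bar>list_avg L (\<lambda>g. f j (a g x)) - (\<integral>x. f j x \<partial>\<nu>)\<bar> \<le> e" by auto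
  have fi: "continuous_on UNIV (f i)" using insert by simp
  obtain F where F: "F \<noteq> []"
    "\<And>x. \<bar>list_avg F (\<lambda>h. list_avg L (\<lambda>g. f i (a g (a h x)))) - (\<integral>x. f i x \<partial>\<nu>)\<bar> \<le> e"
    using list_avg_near_integral[OF cont_list_avg[OF fi, of L] e] integral_list_avg[OF fi L(1)] by auto
  have "\<bar>list_avg (prod_list_add L F) (\<lambda>g. f j (a g x)) - (\<integral>x. f j x \<partial>\<nu>)\<bar> \<le> e"
    if "j \<in> insert i A" for j x
  proof (cases "j = i")
    case True
    then show ?thesis using F by (simp add: list_avg_prod_list_add act_add)
  next
    case False
    then show ?thesis
      unfolding list_avg_prod_list_add act_add
      using L(2)[of j] that by (intro list_avg_abs_diff_le[OF F(1)]) simp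
  qed
  then show ?case using L(1) F(1) by (intro exI[of _ "prod_list_add L F"]) (simp add: prod_list_add_Nil_iff)
qed

end

section \<open>Independence over an equicontinuous system\<close>

text \<open>Since \<open>infdist\<close> to the empty set is 0, \<open>nbhd {} j\<close> is
  everything; hence the assumptions \<open>D \<noteq> {}\<close> in some of the lemmas.\<close>

definition nbhd :: "'a::metric_space set \<Rightarrow> nat \<Rightarrow> 'a set" where
  "nbhd D j = {x. infdist x D < 1 / real (Suc j)}"

lemma open_nbhd: "open (nbhd D j)"
proof -
  have "open ((\<lambda>x. infdist x D) -` {..<1 / real (Suc j)})"
    by (intro open_vimage continuous_on_infdist continuous_on_id) auto
  then show ?thesis by (simp add: nbhd_def vimage_def)
qed

lemma nbhd_antimono: "i \<le> j \<Longrightarrow> nbhd D j \<subseteq> nbhd D i"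
proof -
  assume "i \<le> j"
  then have "1 / real (Suc j) \<le> 1 / real (Suc i)" by (intro divide_left_mono) auto
  then show ?thesis by (auto simp: nbhd_def)
qed

lemma subset_nbhd: "D \<subseteq> nbhd D j"
  by (auto simp: nbhd_def)

lemma INT_nbhd: "closed D \<Longrightarrow> D \<noteq> {} \<Longrightarrow> (\<Inter>j. nbhd D j) = D"
proof
  assume D: "closed D" "D \<noteq> {}"
  show "(\<Inter>j. nbhd D j) \<subseteq> D"
  proof
    fix x assume x: "x \<in> (\<Inter>j. nbhd D j)"
    have "infdist x D \<le> 0"
    proof (rule ccontr)
      assume "\<not> ?thesis"
      then have "0 < infdist x D" by simp
      then obtain j where "inverse (real (Suc j)) < infdist x D" using reals_Archimedean by blast
      moreover have "infdist x D < 1 / real (Suc j)" using x by (simp add: nbhd_def)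
      ultimately show False by (simp add: inverse_eq_divide)
    qed
    then have "infdist x D = 0" using infdist_nonneg[of x D] by linarith
    then show "x \<in> D" using in_closed_iff_infdist_zero[OF D] by blast
  qed
qed (use subset_nbhd in blast)

lemma nbhd_step:
  assumes "x \<in> nbhd D (Suc j)" "dist y x < 1 / real (Suc j) - 1 / real (Suc (Suc j))"
  shows "y \<in> nbhd D j"
  using assms infdist_triangle[of y D x] by (simp add: nbhd_def)

lemma nbhd_dist:
  assumes "x \<in> nbhd D j" "D \<noteq> {}"
  obtains y where "y \<in> D" "dist x y < 1 / real (Suc j)"
proof -
  have "(INF y\<in>D. dist x y) < 1 / real (Suc j)" using assms by (simp add: nbhd_def infdist_notempty)
  then show ?thesis using that assms(2) by (subst (asm) cINF_less_iff) auto
qed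

section \<open>Visit frequencies near a closed set of positive measure\<close>

context equicontinuous_minimal
begin

lemma nbhd_cutoff:
  fixes D :: "'h set"
  obtains \<psi> :: "'h \<Rightarrow> real" where "continuous_on UNIV \<psi>"
    "\<And>x. of_bool (x \<in> nbhd D (Suc j)) \<le> \<psi> x" "\<And>x. \<psi> x \<le> of_bool (x \<in> nbhd D j)"
proof
  define r s where "r = 1 / real (Suc j)" and "s = 1 / real (Suc (Suc j))"
  have rs: "s < r" unfolding r_def s_def by (intro divide_strict_left_mono) auto
  define \<psi> where "\<psi> x = max 0 (min 1 ((r - infdist x D) / (r - s)))" for x
  show "continuous_on UNIV \<psi>"
    unfolding \<psi>_def using rs by (intro continuous_intros) auto
  have nb: "x \<in> nbhd D (Suc j) \<longleftrightarrow> infdist x D < s" "x \<in> nbhd D j \<longleftrightarrow> infdist x D < r" for x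
    by (simp_all add: nbhd_def r_def s_def)
  show "of_bool (x \<in> nbhd D (Suc j)) \<le> \<psi> x" for x
    unfolding nb using rs by (auto simp: \<psi>_def)
  show "\<psi> x \<le> of_bool (x \<in> nbhd D j)" for x
    unfolding nb using rs by (auto simp: \<psi>_def divide_le_0_iff)
qed

definition hits :: "'h set \<Rightarrow> nat \<Rightarrow> 'h \<Rightarrow> 'g \<Rightarrow> real" where
  "hits D j x g = of_bool (a g x \<in> nbhd D j)"

text \<open>A list \<open>L\<close> is good when, seen from every point \<open>x\<close>, it visits the shrinking
  neighbourhoods of \<open>D\<close> about as often as \<open>\<nu>\<close> predicts. The index shift leaves room for a
  continuous function between consecutive neighbourhoods.\<close>

definition good :: "'h set \<Rightarrow> nat \<Rightarrow> 'g list \<Rightarrow> bool" where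
  "good D k L \<longleftrightarrow> L \<noteq> [] \<and> (\<forall>x. \<forall>j\<le>k.
     measure \<nu> D - 1 / real (Suc k) \<le> list_avg L (hits D (Suc j) x) \<and>
     list_avg L (hits D (Suc j) x) \<le> measure \<nu> (nbhd D j) + 1 / real (Suc k))"

lemma good_antimono:
  assumes "good D k' L" "k \<le> k'"
  shows "good D k L"
proof -
  have "1 / real (Suc k') \<le> 1 / real (Suc k)" using assms(2) by (intro divide_left_mono) auto
  with assms show ?thesis unfolding good_def by (smt (verit) le_trans)
qed

lemma good_exists:
  assumes D: "closed D"
  shows "\<exists>L. good D k L"
proof -
  have sets: "D \<in> sets \<nu>" "nbhd D j \<in> sets \<nu>" for j
    using D open_nbhd[of D j] by (simp_all add: sets_nu)
  have "\<exists>\<psi>::'h \<Rightarrow> real. continuous_on UNIV \<psi> \<and> (\<forall>x. of_bool (x \<in> nbhd D (Suc j)) \<le> \<psi> x) \<and>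
      (\<forall>x. \<psi> x \<le> of_bool (x \<in> nbhd D j))" for j
    using nbhd_cutoff[of D j] by metis
  then obtain \<psi> :: "nat \<Rightarrow> 'h \<Rightarrow> real" where \<psi>: "\<And>j. continuous_on UNIV (\<psi> j)"
    "\<And>j x. of_bool (x \<in> nbhd D (Suc j)) \<le> \<psi> j x" "\<And>j x. \<psi> j x \<le> of_bool (x \<in> nbhd D j)"
    by metis
  have int_le: "(\<integral>x. \<psi> j x \<partial>\<nu>) \<le> measure \<nu> (nbhd D j)" for j
  proof -
    have "\<psi> j x \<le> indicator (nbhd D j) x" for x
      using \<psi>(3)[of j x] by (auto simp: indicator_def)
    moreover have "integrable \<nu> (indicator (nbhd D j) :: 'h \<Rightarrow> real)"
      using sets(2) by (intro integrable_real_indicator) (auto simp: emeasure_eq_measure)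
    ultimately have "(\<integral>x. \<psi> j x \<partial>\<nu>) \<le> (\<integral>x. indicator (nbhd D j) x \<partial>\<nu>)"
      using cont_integrable[OF \<psi>(1)] by (intro integral_mono) auto
    then show ?thesis by (simp add: space_nu)
  qed
  have le_int: "measure \<nu> D \<le> (\<integral>x. \<psi> j x \<partial>\<nu>)" for j
  proof -
    have "indicator D x \<le> \<psi> j x" for x
    proof -
      have "(indicator D x :: real) \<le> of_bool (x \<in> nbhd D (Suc j))"
        using subset_nbhd[of D "Suc j"] by (auto simp: indicator_def)
      then show ?thesis using \<psi>(2)[of x j] by (rule order_trans)
    qed
    moreover have "integrable \<nu> (indicator D :: 'h \<Rightarrow> real)"
      using sets(1) by (intro integrable_real_indicator) (auto simp: emeasure_eq_measure)
    ultimately have "(\<integral>x. indicator D x \<partial>\<nu>) \<le> (\<integral>x. \<psi> j x \<partial>\<nu>)"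
      using cont_integrable[OF \<psi>(1)] by (intro integral_mono) auto
    then show ?thesis by (simp add: space_nu)
  qed
  \<comment> \<open>The upper bound on \<open>hits D (Suc j)\<close> uses the cutoff
    \<open>\<psi> j\<close>, the lower bound uses \<open>\<psi> (Suc j)\<close>; hence the range up
    to \<open>Suc k\<close>.\<close>
  obtain L where L: "L \<noteq> []" "\<And>j x. j \<le> Suc k \<Longrightarrow>
      \<bar>list_avg L (\<lambda>g. \<psi> j (a g x)) - (\<integral>x. \<psi> j x \<partial>\<nu>)\<bar> \<le> 1 / real (Suc k)"
    using list_avg_near_integral_finite[of "{..Suc k}" \<psi> "1 / real (Suc k)"] \<psi>(1) by auto
  have "measure \<nu> D - 1 / real (Suc k) \<le> list_avg L (hits D (Suc j) x)"
    and "list_avg L (hits D (Suc j) x) \<le> measure \<nu> (nbhd D j) + 1 / real (Suc k)" if "j \<le> k" for j x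
  proof -
    have "list_avg L (\<lambda>g. \<psi> (Suc j) (a g x)) \<le> list_avg L (hits D (Suc j) x)"
      using \<psi>(3) by (intro list_avg_mono) (simp add: hits_def)
    then show "measure \<nu> D - 1 / real (Suc k) \<le> list_avg L (hits D (Suc j) x)"
      using L(2)[of "Suc j" x] le_int[of "Suc j"] that by (simp add: abs_le_iff)
    have "list_avg L (hits D (Suc j) x) \<le> list_avg L (\<lambda>g. \<psi> j (a g x))"
      using \<psi>(2) by (intro list_avg_mono) (simp add: hits_def)
    then show "list_avg L (hits D (Suc j) x) \<le> measure \<nu> (nbhd D j) + 1 / real (Suc k)"
      using L(2)[of j x] int_le[of j] that by (simp add: abs_le_iff)
  qed
  then show ?thesis using L(1) unfolding good_def by blast
qed

text \<open>A substitute for: a set of positive Haar measure of elements of the closure of the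
  group moves all of \<open>F\<close> into \<open>D\<close>.\<close>

definition big :: "'h set \<Rightarrow> 'h set \<Rightarrow> bool" where
  "big D F \<longleftrightarrow> (\<exists>c>0. \<forall>k. \<exists>L. good D k L \<and>
     c \<le> list_avg L (\<lambda>g. of_bool (\<forall>x\<in>F. a g x \<in> nbhd D k)))"

lemma big_antimono:
  assumes "big D F" "F' \<subseteq> F"
  shows "big D F'"
proof -
  obtain c where c: "c > 0" "\<And>k. \<exists>L. good D k L \<and>
     c \<le> list_avg L (\<lambda>g. of_bool (\<forall>x\<in>F. a g x \<in> nbhd D k))"
    using assms(1) unfolding big_def by blast
  have "list_avg L (\<lambda>g. of_bool (\<forall>x\<in>F. a g x \<in> nbhd D k))
      \<le> list_avg L (\<lambda>g. of_bool (\<forall>x\<in>F'. a g x \<in> nbhd D k))" for L k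
    using assms(2) by (intro list_avg_mono) auto
  with c show ?thesis unfolding big_def by (meson order_trans)
qed

text \<open>For one point, \<open>good\<close> already bounds the frequency of visits from below by
  the measure of \<open>D\<close> up to an error. Passing to a finer level \<open>k'\<close> makes
  this error at most half of the measure.\<close>

lemma big_singleton:
  assumes "closed D" "measure \<nu> D > 0"
  shows "big D {x}"
  unfolding big_def
proof (intro exI[of _ "measure \<nu> D / 2"] conjI allI)
  fix k
  obtain n where n: "inverse (real (Suc n)) < measure \<nu> D / 2"
    using reals_Archimedean[of "measure \<nu> D / 2"] assms(2) by auto
  define k' where "k' = max k n"
  obtain L where L: "good D k' L" using good_exists[OF assms(1)] by blast
  have "1 / real (Suc k') \<le> inverse (real (Suc n))"
    unfolding inverse_eq_divide k'_def by (intro divide_left_mono) auto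
  then have "measure \<nu> D / 2 \<le> measure \<nu> D - 1 / real (Suc k')" using n by simp
  also have "\<dots> \<le> list_avg L (hits D (Suc k') x)" using L by (simp add: good_def)
  also have "\<dots> \<le> list_avg L (\<lambda>g. of_bool (\<forall>x\<in>{x}. a g x \<in> nbhd D k))"
  proof (intro list_avg_mono)
    have "k \<le> Suc k'" by (simp add: k'_def)
    from nbhd_antimono[OF this, of D]
    show "hits D (Suc k') x g \<le> of_bool (\<forall>x\<in>{x}. a g x \<in> nbhd D k)" for g
      by (auto simp: hits_def)
  qed
  finally show "\<exists>L. good D k L \<and> measure \<nu> D / 2 \<le> list_avg L (\<lambda>g. of_bool (\<forall>x\<in>{x}. a g x \<in> nbhd D k))"
    using good_antimono[OF L, of k] by (auto simp: k'_def)
qed (use assms in simp)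

lemma measure_nbhd_small:
  assumes D: "closed D" "D \<noteq> {}" and e: "e > 0"
  obtains j where "measure \<nu> (nbhd D j) < measure \<nu> D + e"
proof -
  have "(\<lambda>j. measure \<nu> (nbhd D j)) \<longlonglongrightarrow> measure \<nu> (\<Inter>j. nbhd D j)"
    using open_nbhd[of D] nbhd_antimono[of _ _ D]
    by (intro finite_Lim_measure_decseq) (auto simp: sets_nu decseq_def)
  then have "eventually (\<lambda>j. measure \<nu> (nbhd D j) < measure \<nu> D + e) sequentially"
    unfolding INT_nbhd[OF D] using e by (intro order_tendstoD(2)) auto
  then show ?thesis using that by (meson eventually_happens' sequentially_bot)
qed

text \<open>The new points stay so close to \<open>F\<close> that a group element moving \<open>F\<close> into a small
  neighbourhood of \<open>D\<close> moves them into a slightly larger one; the loss incurred by returning to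
  the small one is bounded by the measure of an annulus around \<open>D\<close>.\<close>

lemma big_extend:
  fixes N :: nat
  assumes D: "closed D" "D \<noteq> {}" and W: "\<And>j. j < N \<Longrightarrow> D \<subseteq> closure (W j)"
    and F: "finite F" and big: "big D F" and \<delta>: "\<delta> > 0"
  shows "\<exists>g v. (\<forall>x\<in>F. \<forall>j<N. dist (v x j) x < \<delta> \<and> a g (v x j) \<in> W j) \<and>
    big D ((\<lambda>(x, j). v x j) ` (F \<times> {..<N}))"
proof -
  obtain c where c: "c > 0" "\<And>k. \<exists>L. good D k L \<and>
     c \<le> list_avg L (\<lambda>g. of_bool (\<forall>x\<in>F. a g x \<in> nbhd D k))"
    using big unfolding big_def by blast
  define m where "m = card (F \<times> {..<N})"
  \<comment> \<open>Each of the at most \<open>m\<close> new points will cost a frequency of at most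
    \<open>2 * \<eta>\<close>, so that \<open>c / 2\<close> is left. The constant may shrink at each
    extension, since \<open>big\<close> asks only for some positive one.\<close>
  define \<eta> where "\<eta> = c / (4 * (real m + 1))"
  have \<eta>: "\<eta> > 0" using c(1) by (simp add: \<eta>_def)
  obtain j0 where j0: "measure \<nu> (nbhd D j0) < measure \<nu> D + \<eta>"
    using measure_nbhd_small[OF D \<eta>] by blast
  obtain k0 where k0: "inverse (real (Suc k0)) < \<eta> / 2" using reals_Archimedean[of "\<eta> / 2"] \<eta> by auto
  \<comment> \<open>The gap between two consecutive radii: points moved by less than
    \<open>\<rho>\<close> pass from \<open>nbhd D (Suc (Suc j0))\<close> at worst to
    \<open>nbhd D (Suc j0)\<close>.\<close>
  define \<rho> where "\<rho> = 1 / real (Suc (Suc j0)) - 1 / real (Suc (Suc (Suc j0)))"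
  have "\<rho> > 0" unfolding \<rho>_def by (simp add: divide_strict_left_mono)
  then obtain d1 where d1: "d1 > 0" "\<And>g x y. dist x y < d1 \<Longrightarrow> dist (a g x) (a g y) < \<rho>"
    using equicontinuousE by metis
  have "min \<delta> d1 > 0" using \<delta> d1 by simp
  \<comment> \<open>Equicontinuity is uniform over the whole group, so it also controls
    \<open>a (- g)\<close>, which pulls a point of \<open>W j\<close> near \<open>a g x\<close> back
    to a point near \<open>x\<close>.\<close>
  then obtain d2 where d2: "d2 > 0" "\<And>g x y. dist x y < d2 \<Longrightarrow> dist (a g x) (a g y) < min \<delta> d1"
    using equicontinuousE by metis
  obtain k1 where k1: "inverse (real (Suc k1)) < d2 / 2" using reals_Archimedean[of "d2 / 2"] d2 by auto
  obtain L where L: "good D k1 L" "c \<le> list_avg L (\<lambda>g. of_bool (\<forall>x\<in>F. a g x \<in> nbhd D k1))"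
    using c(2) by blast
  have "\<exists>g. \<forall>x\<in>F. a g x \<in> nbhd D k1"
  proof (rule ccontr)
    assume "\<not> ?thesis"
    then have "(\<lambda>g. of_bool (\<forall>x\<in>F. a g x \<in> nbhd D k1)) = (\<lambda>_. 0 :: real)" by auto
    then show False using L c(1) list_avg_const[of L 0] by (simp add: good_def)
  qed
  then obtain g where g: "\<And>x. x \<in> F \<Longrightarrow> a g x \<in> nbhd D k1" by blast
  have "\<exists>v. dist v x < min \<delta> d1 \<and> a g v \<in> W j" if xj: "x \<in> F" "j < N" for x j
  proof -
    obtain y where y: "y \<in> D" "dist (a g x) y < 1 / real (Suc k1)"
      using nbhd_dist[OF g[OF xj(1)] D(2)] by blast
    then have "y \<in> closure (W j)" using W[OF xj(2)] by blast
    then have "\<exists>w\<in>W j. dist w y < 1 / real (Suc k1)"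
      unfolding closure_approachable by simp
    then obtain w where w: "w \<in> W j" "dist w y < 1 / real (Suc k1)" by blast
    have "dist w (a g x) < d2"
      using y(2) w(2) k1 dist_triangle2[of w "a g x" y] by (simp add: inverse_eq_divide)
    then have "dist (a (- g) w) (a (- g) (a g x)) < min \<delta> d1" by (rule d2)
    then show ?thesis using w(1) by (intro exI[of _ "a (- g) w"]) (simp add: act_uminus)
  qed
  then obtain v where v: "\<And>x j. x \<in> F \<Longrightarrow> j < N \<Longrightarrow> dist (v x j) x < min \<delta> d1 \<and> a g (v x j) \<in> W j"
    by metis
  have "big D ((\<lambda>(x, j). v x j) ` (F \<times> {..<N}))"
    unfolding big_def
  proof (intro exI[of _ "c / 2"] conjI allI)
    fix k
    define k' where "k' = max k (max k0 (Suc (Suc (Suc j0))))"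
    obtain L where L: "good D k' L" "c \<le> list_avg L (\<lambda>g. of_bool (\<forall>x\<in>F. a g x \<in> nbhd D k'))"
      using c(2) by blast
    let ?u = "\<lambda>p. v (fst p) (snd p)"
    \<comment> \<open>The value is 1 when the point indexed by \<open>p\<close> is sent into the
      annulus between the two neighbourhoods, and 0 otherwise. Once \<open>F\<close> is sent into
      \<open>nbhd D k'\<close>, a new point can miss \<open>nbhd D k\<close> only in this
      way.\<close>
    let ?ann = "\<lambda>p g. hits D (Suc j0) (?u p) g - hits D (Suc k') (?u p) g"
    have sub: "nbhd D (Suc k') \<subseteq> nbhd D (Suc j0)" "nbhd D k' \<subseteq> nbhd D (Suc (Suc j0))"
      "nbhd D (Suc k') \<subseteq> nbhd D k"
      by (intro nbhd_antimono; simp add: k'_def)+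
    have pw: "of_bool (\<forall>x\<in>F. a h x \<in> nbhd D k') - (\<Sum>p\<in>F \<times> {..<N}. ?ann p h)
      \<le> of_bool (\<forall>x\<in>(\<lambda>(x, j). v x j) ` (F \<times> {..<N}). a h x \<in> nbhd D k)" (is "?l \<le> ?r") for h
    proof -
      have nn: "?ann p h \<ge> 0" for p using sub(1) by (auto simp: hits_def)
      show ?thesis
      proof (cases "(\<forall>x\<in>F. a h x \<in> nbhd D k') \<and> ?r = 0")
        case True
        then obtain p where p: "p \<in> F \<times> {..<N}" "a h (?u p) \<notin> nbhd D k" by (auto split: if_splits)
        have "dist (?u p) (fst p) < d1" using v p(1) by (auto simp: mem_Times_iff)
        then have "dist (a h (?u p)) (a h (fst p)) < \<rho>" by (rule d1)
        moreover have "a h (fst p) \<in> nbhd D (Suc (Suc j0))" using True p(1) sub(2) by auto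
        ultimately have "a h (?u p) \<in> nbhd D (Suc j0)" unfolding \<rho>_def using nbhd_step by blast
        then have "?ann p h = 1" using p(2) sub(3) by (auto simp: hits_def)
        moreover have "?ann p h \<le> (\<Sum>p\<in>F \<times> {..<N}. ?ann p h)"
          using p(1) F nn by (intro member_le_sum) auto
        ultimately show ?thesis by auto
      next
        case False
        moreover have "0 \<le> (\<Sum>p\<in>F \<times> {..<N}. ?ann p h)" using nn by (intro sum_nonneg)
        ultimately show ?thesis by (auto split: if_splits)
      qed
    qed
    \<comment> \<open>The excess of \<open>measure \<nu> (nbhd D j0)\<close> over
      \<open>measure \<nu> D\<close> is below \<open>\<eta>\<close>, and each of the two frequency
      errors of \<open>L\<close> is below \<open>\<eta> / 2\<close>.\<close>
    have ann: "list_avg L (?ann p) \<le> 2 * \<eta>" for p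
    proof -
      have "j0 \<le> k'" by (simp add: k'_def)
      then have "list_avg L (hits D (Suc j0) (?u p)) \<le> measure \<nu> (nbhd D j0) + 1 / real (Suc k')"
        "measure \<nu> D - 1 / real (Suc k') \<le> list_avg L (hits D (Suc k') (?u p))"
        using L(1) by (auto simp: good_def)
      moreover have "1 / real (Suc k') \<le> inverse (real (Suc k0))"
        unfolding inverse_eq_divide k'_def by (intro divide_left_mono) auto
      ultimately show ?thesis using j0 k0 by (simp add: list_avg_diff)
    qed
    have "c / 2 \<le> c - real m * (2 * \<eta>)"
      using c(1) by (simp add: \<eta>_def field_simps)
    also have "\<dots> \<le> list_avg L (\<lambda>g. of_bool (\<forall>x\<in>F. a g x \<in> nbhd D k')) - (\<Sum>p\<in>F \<times> {..<N}. list_avg L (?ann p))"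
      using L(2) sum_bounded_above[of "F \<times> {..<N}" "\<lambda>p. list_avg L (?ann p)" "2 * \<eta>"] ann
      by (intro diff_mono) (auto simp: m_def)
    also have "\<dots> = list_avg L (\<lambda>g. of_bool (\<forall>x\<in>F. a g x \<in> nbhd D k') - (\<Sum>p\<in>F \<times> {..<N}. ?ann p g))"
      using F by (subst list_avg_sum[symmetric]) (simp_all add: list_avg_diff)
    also have "\<dots> \<le> list_avg L (\<lambda>g. of_bool (\<forall>x\<in>(\<lambda>(x, j). v x j) ` (F \<times> {..<N}). a g x \<in> nbhd D k))"
      using pw by (intro list_avg_mono)
    finally show "\<exists>L. good D k L \<and> c / 2 \<le> list_avg L
        (\<lambda>g. of_bool (\<forall>x\<in>(\<lambda>(x, j). v x j) ` (F \<times> {..<N}). a g x \<in> nbhd D k))"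
      using good_antimono[OF L(1), of k] by (auto simp: k'_def)
  qed (use c in simp)
  with v show ?thesis by (intro exI[of _ g] exI[of _ v]) auto
qed

text \<open>At stage \<open>n\<close> there is one point of \<open>H\<close> for each word of length
  \<open>n\<close>. As these points together are \<open>big\<close>, one new group element serves
  all words, and each point is perturbed separately for each possible next symbol.\<close>

lemma independent_sequence:
  fixes N :: nat
  assumes D: "closed D" "measure \<nu> D > 0"
    and W: "\<And>j. j < N \<Longrightarrow> open (W j)" "\<And>j. j < N \<Longrightarrow> D \<subseteq> closure (W j)"
  shows "\<exists>s :: nat \<Rightarrow> 'g. \<forall>n \<sigma>. (\<forall>i<n. \<sigma> i < N) \<longrightarrow> (\<exists>u. \<forall>i<n. a (s i) u \<in> W (\<sigma> i))"
proof -
  have D_ne: "D \<noteq> {}" using D(2) by auto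
  define words where "words n = {w :: nat list. set w \<subseteq> {..<N} \<and> length w = n}" for n
  have fin: "finite (words n)" for n
    unfolding words_def by (rule finite_lists_length_eq) simp
  define stage where "stage n z \<longleftrightarrow> length (fst z) = n \<and>
      (\<forall>w\<in>words n. \<forall>i<n. a (fst z ! i) (snd z w) \<in> W (w ! i)) \<and> big D (snd z ` words n)"
    for n and z :: "'g list \<times> (nat list \<Rightarrow> 'h)"
  define ext where "ext n z z' \<longleftrightarrow> (\<exists>g. fst z' = fst z @ [g])"
    for n :: nat and z z' :: "'g list \<times> (nat list \<Rightarrow> 'h)"
  have "\<exists>f. \<forall>n. stage n (f n) \<and> ext n (f n) (f (Suc n))"
  proof (rule dependent_nat_choice)
    have "snd ([] :: 'g list, \<lambda>_. x) ` words 0 = {x}" for x :: 'h by (auto simp: words_def)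
    then show "\<exists>z. stage 0 z"
      using big_singleton[OF D] by (intro exI[of _ "([], \<lambda>_. undefined)"]) (simp add: stage_def)
  next
    fix z n assume z: "stage n z"
    obtain gs u where gu: "z = (gs, u)" by (cases z)
    \<comment> \<open>The \<open>W j\<close> are open and there are finitely many words, so
      perturbations below a common \<open>\<delta>\<close> preserve all visits secured at earlier
      stages.\<close>
    have "eventually (\<lambda>\<delta>. \<forall>w\<in>words n. \<forall>y. dist y (u w) < \<delta> \<longrightarrow> (\<forall>i<n. a (gs ! i) y \<in> W (w ! i))) (at_right 0)"
    proof (intro eventually_ball_finite fin ballI)
      fix w assume w: "w \<in> words n"
      define O' where "O' = (\<Inter>i\<in>{..<n}. a (gs ! i) -` W (w ! i))"
      have "open O'" unfolding O'_def
        using w by (intro open_INT ballI open_vimage act_cont W(1)) (auto simp: words_def dest: nth_mem)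
      moreover have "u w \<in> O'" using z w gu by (auto simp: stage_def O'_def)
      ultimately obtain e where e: "e > 0" "\<And>y. dist y (u w) < e \<Longrightarrow> y \<in> O'"
        by (auto simp: open_dist)
      have "eventually (\<lambda>\<delta>. \<delta> < e) (at_right 0)" using e(1) by (intro eventually_at_rightI[of 0 e]) auto
      then show "eventually (\<lambda>\<delta>. \<forall>y. dist y (u w) < \<delta> \<longrightarrow> (\<forall>i<n. a (gs ! i) y \<in> W (w ! i))) (at_right 0)"
        by eventually_elim (use e(2) in \<open>fastforce simp: O'_def\<close>)
    qed
    moreover have "eventually (\<lambda>\<delta>::real. \<delta> > 0) (at_right 0)" by (rule eventually_at_right_less)
    ultimately have "eventually (\<lambda>\<delta>. \<delta> > 0 \<and> (\<forall>w\<in>words n. \<forall>y. dist y (u w) < \<delta> \<longrightarrow>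
        (\<forall>i<n. a (gs ! i) y \<in> W (w ! i)))) (at_right 0)" by (intro eventually_conj)
    then obtain \<delta> where \<delta>: "\<delta> > 0"
      "\<And>w y. w \<in> words n \<Longrightarrow> dist y (u w) < \<delta> \<Longrightarrow> (\<forall>i<n. a (gs ! i) y \<in> W (w ! i))"
      using eventually_happens'[OF trivial_limit_at_right_real] by blast
    have "finite (u ` words n)" "big D (u ` words n)" using fin z gu by (auto simp: stage_def)
    from big_extend[where N = N and W = W, OF D(1) D_ne W(2) this \<delta>(1)] obtain g v where
      v: "\<And>x j. x \<in> u ` words n \<Longrightarrow> j < N \<Longrightarrow> dist (v x j) x < \<delta> \<and> a g (v x j) \<in> W j"
      and bg: "big D ((\<lambda>(x, j). v x j) ` (u ` words n \<times> {..<N}))" by blast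
    define u' where "u' w = v (u (butlast w)) (last w)" for w
    have bl: "butlast w \<in> words n" "last w < N" "w \<noteq> []" if "w \<in> words (Suc n)" for w
      using that by (cases w rule: rev_cases; auto simp: words_def)+
    have "u' ` words (Suc n) \<subseteq> (\<lambda>(x, j). v x j) ` (u ` words n \<times> {..<N})"
    proof
      fix x assume "x \<in> u' ` words (Suc n)"
      then obtain w where "w \<in> words (Suc n)" "x = u' w" by blast
      with bl show "x \<in> (\<lambda>(x, j). v x j) ` (u ` words n \<times> {..<N})"
        by (intro image_eqI[of _ _ "(u (butlast w), last w)"]) (auto simp: u'_def)
    qed
    with bg have "big D (u' ` words (Suc n))" by (rule big_antimono)
    moreover have "a ((gs @ [g]) ! i) (u' w) \<in> W (w ! i)" if w: "w \<in> words (Suc n)" and i: "i < Suc n" for w i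
    proof -
      have len: "length gs = n" "length w = Suc n" using z gu w by (auto simp: stage_def words_def)
      have vw: "dist (u' w) (u (butlast w)) < \<delta>" "a g (u' w) \<in> W (last w)"
        using v[of "u (butlast w)" "last w"] bl[OF w] by (auto simp: u'_def)
      show ?thesis
      proof (cases "i < n")
        case True
        then show ?thesis using \<delta>(2)[OF bl(1)[OF w] vw(1)] len by (simp add: nth_append nth_butlast)
      next
        case False
        then have "i = n" using i by simp
        then show ?thesis using vw(2) len bl(3)[OF w] by (simp add: nth_append last_conv_nth)
      qed
    qed
    moreover have "length gs = n" using z gu by (simp add: stage_def)
    ultimately show "\<exists>z'. stage (Suc n) z' \<and> ext n z z'"
      by (intro exI[of _ "(gs @ [g], u')"]) (auto simp: stage_def ext_def gu)
  qed
  then obtain f where f: "\<And>n. stage n (f n)" "\<And>n. ext n (f n) (f (Suc n))" by blast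
  define s where "s n = fst (f (Suc n)) ! n" for n
  have len: "length (fst (f n)) = n" for n using f(1)[of n] by (simp add: stage_def)
  have nth: "fst (f n) ! i = s i" if "i < n" for n i
    using that
  proof (induction n)
    case (Suc n)
    obtain g where g: "fst (f (Suc n)) = fst (f n) @ [g]" using f(2)[of n] by (auto simp: ext_def)
    show ?case
    proof (cases "i = n")
      case False
      then have "i < n" using Suc.prems by simp
      then show ?thesis using Suc.IH g len by (simp add: nth_append)
    qed (simp add: s_def)
  qed simp
  have "\<exists>u. \<forall>i<n. a (s i) u \<in> W (\<sigma> i)" if "\<forall>i<n. \<sigma> i < N" for n \<sigma>
  proof -
    have "map \<sigma> [0..<n] \<in> words n" using that by (auto simp: words_def)
    then have "\<forall>i<n. a (fst (f n) ! i) (snd (f n) (map \<sigma> [0..<n])) \<in> W (map \<sigma> [0..<n] ! i)"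
      using f(1)[of n] by (auto simp: stage_def)
    then show ?thesis using nth by auto
  qed
  then show ?thesis by blast
qed

end

section \<open>Lifting independence through the factor map\<close>

lemma residual_dense:
  fixes S :: "'a::metric_space set"
  assumes "compact (UNIV :: 'a set)" "residual S" "open U" "U \<noteq> {}"
  shows "U \<inter> S \<noteq> {}"
proof -
  obtain F :: "nat \<Rightarrow> 'a set" where F: "\<And>n. open (F n)" "\<And>n. closure (F n) = UNIV" "(\<Inter>n. F n) \<subseteq> S"
    using assms(2) unfolding residual_def by blast
  have cs: "compact_space (euclidean :: 'a topology)" using assms(1) by (simp add: compact_space_def)
  have "closure (\<Inter>(range F)) = UNIV"
    using Baire_category[of "euclidean :: 'a topology" "range F"] F
      compact_imp_locally_compact_space[OF cs] compact_Hausdorff_imp_regular_space[OF cs]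
    by auto
  then have "U \<inter> \<Inter>(range F) \<noteq> {}" using assms(3,4) by (metis Int_UNIV_right open_Int_closure_eq_empty inf_commute inf_top_right)
  then show ?thesis using F(3) by blast
qed

lemma G_system_bij:
  assumes "G_system act"
  shows "act 0 x = x" "act (g + h) x = act g (act h x)" "continuous_on UNIV (act g)"
    "act (- g) (act g x) = x" "act g (act (- g) x) = x"
proof -
  show *: "act 0 x = x" "act (g + h) x = act g (act h x)" "continuous_on UNIV (act g)" for g h x
    using assms by (auto simp: G_system_def)
  show "act (- g) (act g x) = x" "act g (act (- g) x) = x"
    by (simp_all add: *(2)[symmetric] *(1))
qed

lemma minimal_system_factor:
  fixes \<pi> :: "'x::topological_space \<Rightarrow> 'h::topological_space"
  assumes "minimal_system act" "continuous_on UNIV \<pi>" "surj \<pi>" "\<And>g x. \<pi> (act g x) = actH g (\<pi> x)"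
  shows "minimal_system actH"
  unfolding minimal_system_def
proof
  fix y
  obtain x where x: "y = \<pi> x" using assms(3) by blast
  have "UNIV = \<pi> ` closure (range (\<lambda>g. act g x))"
    using assms(1,3) by (simp add: minimal_system_def)
  also have "\<dots> \<subseteq> closure (\<pi> ` range (\<lambda>g. act g x))"
    using continuous_on_subset[OF assms(2)] by (intro image_closure_subset) (auto intro: closure_subset[THEN subsetD])
  also have "\<pi> ` range (\<lambda>g. act g x) = range (\<lambda>g. actH g y)" by (simp add: x assms(4)[symmetric] image_image)
  finally show "closure (range (\<lambda>g. actH g y)) = UNIV" by auto
qed

lemma interior_finite_Union_closed_empty:
  assumes "finite A" "\<And>C. C \<in> A \<Longrightarrow> closed C \<and> interior C = {}"
  shows "interior (\<Union>A) = {}"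
  using assms
proof (induction A)
  case (insert C A)
  then show ?case using interior_closed_Un_empty_interior[of C "\<Union>A"] by auto
qed simp

lemma distinct_balls_disjoint:
  fixes xs :: "'a::metric_space list"
  assumes "distinct xs"
  obtains d where "d > 0" "\<And>i j. i < length xs \<Longrightarrow> j < length xs \<Longrightarrow> i \<noteq> j \<Longrightarrow>
    cball (xs ! i) d \<inter> cball (xs ! j) d = {}"
proof -
  obtain e where e: "e > 0" "\<And>x y. x \<in> set xs \<Longrightarrow> y \<in> set xs \<Longrightarrow> x \<noteq> y \<Longrightarrow> e \<le> dist x y"
  proof -
    \<comment> \<open>The element 1 makes the minimum meaningful for lists with fewer than two
      entries.\<close>
    define E where "E = insert 1 ((\<lambda>(x, y). dist x y) ` {(x, y). x \<in> set xs \<and> y \<in> set xs \<and> x \<noteq> y})"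
    have "{(x, y). x \<in> set xs \<and> y \<in> set xs \<and> x \<noteq> y} \<subseteq> set xs \<times> set xs" by auto
    then have fin: "finite E" unfolding E_def by (meson finite.insertI finite_imageI finite_SigmaI finite_set finite_subset)
    have "Min E \<in> E" using fin by (intro Min_in) (auto simp: E_def)
    then have "Min E > 0" by (auto simp: E_def)
    moreover have "Min E \<le> dist x y" if "x \<in> set xs" "y \<in> set xs" "x \<noteq> y" for x y
      using fin that by (intro Min_le) (auto simp: E_def)
    ultimately show ?thesis using that by blast
  qed
  show ?thesis
  proof
    show "e / 3 > 0" using e by simp
    fix i j assume ij: "i < length xs" "j < length xs" "i \<noteq> j"
    then have "e \<le> dist (xs ! i) (xs ! j)" using e(2) assms by (simp add: nth_eq_iff_index_eq)
    moreover have "dist (xs ! i) (xs ! j) \<le> 2 * (e / 3)"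
      if "z \<in> cball (xs ! i) (e / 3)" "z \<in> cball (xs ! j) (e / 3)" for z
      using that dist_triangle2[of "xs ! i" "xs ! j" z] by simp
    ultimately show "cball (xs ! i) (e / 3) \<inter> cball (xs ! j) (e / 3) = {}" using e(1) by fastforce
  qed
qed

section \<open>Images of balls under the factor map\<close>

locale equicontinuous_factor = equicontinuous_minimal actH \<nu>
  for actH :: "'g::group_add \<Rightarrow> 'h::metric_space \<Rightarrow> 'h" and \<nu> +
  fixes act :: "'g \<Rightarrow> 'x::metric_space \<Rightarrow> 'x" and \<pi> :: "'x \<Rightarrow> 'h"
  assumes compact_X: "compact (UNIV :: 'x set)"
    and G_system_X: "G_system act" and minimal_X: "minimal_system act"
    and cont_pi: "continuous_on UNIV \<pi>" and surj_pi: "surj \<pi>"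
    and equivariant: "\<And>g x. \<pi> (act g x) = actH g (\<pi> x)"
begin

lemma compact_image_cball: "compact (\<pi> ` cball x r)"
proof -
  have "compact (cball x r)" using compact_Int_closed[OF compact_X closed_cball, of x r] by simp
  then show ?thesis using compact_continuous_image continuous_on_subset[OF cont_pi] by blast
qed

text \<open>By minimality and compactness finitely many translates of the ball cover the space, so
  finitely many translates of its closed image cover \<open>H\<close>. A finite union of closed sets
  with empty interior has empty interior, so the image cannot have empty interior.\<close>

lemma interior_image_cball_nonempty:
  assumes "r > 0"
  shows "interior (\<pi> ` cball x r) \<noteq> {}"
proof
  let ?C = "\<pi> ` cball x r"
  assume empty: "interior ?C = {}"
  have "z \<in> (\<Union>g. act g -` ball x r)" for z
  proof -
    have "x \<in> closure (range (\<lambda>g. act g z))" using minimal_X by (simp add: minimal_system_def)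
    then show ?thesis using assms by (auto simp: closure_approachable dist_commute)
  qed
  moreover have "open (act g -` ball x r)" for g
    using G_system_bij(3)[OF G_system_X] by (intro open_vimage) auto
  ultimately obtain F where F: "finite F" "UNIV \<subseteq> (\<Union>g\<in>F. act g -` ball x r)"
    using compact_X by (elim compactE_image[of _ UNIV "\<lambda>g. act g -` ball x r"]) auto
  have "closed (actH g -` ?C) \<and> interior (actH g -` ?C) = {}" for g
  proof
    show "closed (actH g -` ?C)"
      using compact_imp_closed[OF compact_image_cball] act_cont by (intro closed_vimage) auto
    have "open (actH (- g) -` interior (actH g -` ?C))"
      by (intro open_vimage act_cont) auto
    moreover have "actH (- g) -` interior (actH g -` ?C) \<subseteq> ?C"
    proof
      fix y assume "y \<in> actH (- g) -` interior (actH g -` ?C)"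
      then have "actH g (actH (- g) y) \<in> ?C" using interior_subset by fastforce
      then show "y \<in> ?C" by (simp add: act_uminus)
    qed
    ultimately have "actH (- g) -` interior (actH g -` ?C) = {}"
      using interior_maximal empty by blast
    moreover have "actH g z \<in> actH (- g) -` S" if "z \<in> S" for z S
      using that by (simp add: act_uminus)
    ultimately show "interior (actH g -` ?C) = {}" by blast
  qed
  then have "interior (\<Union>g\<in>F. actH g -` ?C) = {}"
    using F(1) by (intro interior_finite_Union_closed_empty) auto
  moreover have "y \<in> (\<Union>g\<in>F. actH g -` ?C)" for y
  proof -
    obtain z where z: "y = \<pi> z" using surj_pi by blast
    obtain g where "g \<in> F" "act g z \<in> ball x r" using F(2) by blast
    then have "actH g y \<in> ?C" unfolding z equivariant[symmetric] by (intro imageI) auto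
    then show ?thesis using \<open>g \<in> F\<close> by blast
  qed
  then have "(\<Union>g\<in>F. actH g -` ?C) = UNIV" by blast
  ultimately show False by simp
qed

text \<open>The map need not be open, so a point of the image need not be interior. Arbitrarily
  small balls around a preimage \<open>z\<close> still have images with nonempty interior, and
  \<open>r < e\<close> leaves room for them inside the larger ball.\<close>

lemma image_cball_subset_closure_interior:
  assumes "r < e"
  shows "\<pi> ` cball x r \<subseteq> closure (interior (\<pi> ` cball x e))"
proof
  fix y assume "y \<in> \<pi> ` cball x r"
  then obtain z where z: "z \<in> cball x r" "y = \<pi> z" by blast
  show "y \<in> closure (interior (\<pi> ` cball x e))"
    unfolding closure_approachable
  proof (intro allI impI)
    fix \<epsilon> :: real assume "\<epsilon> > 0"
    then obtain d where d: "d > 0" "\<And>w. dist w z < d \<Longrightarrow> dist (\<pi> w) y < \<epsilon>"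
      using cont_pi z(2) unfolding continuous_on_iff by (metis UNIV_I)
    define \<rho> where "\<rho> = min (e - r) (d / 2)"
    have \<rho>: "\<rho> > 0" using d assms by (simp add: \<rho>_def)
    have sub: "cball z \<rho> \<subseteq> cball x e"
    proof
      fix w assume "w \<in> cball z \<rho>"
      then show "w \<in> cball x e" using z(1) dist_triangle[of x w z] by (simp add: \<rho>_def)
    qed
    obtain y' where y': "y' \<in> interior (\<pi> ` cball z \<rho>)"
      using interior_image_cball_nonempty[OF \<rho>] by blast
    then obtain w where "w \<in> cball z \<rho>" "y' = \<pi> w" using interior_subset by blast
    then have "dist y' y < \<epsilon>" using d by (intro d(2)[of w, folded \<open>y' = \<pi> w\<close>]) (simp add: \<rho>_def dist_commute)
    moreover have "y' \<in> interior (\<pi> ` cball x e)"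
      using y' interior_mono[OF image_mono[OF sub]] by blast
    ultimately show "\<exists>y'\<in>interior (\<pi> ` cball x e). dist y' y < \<epsilon>" by blast
  qed
qed

text \<open>If every distinct tuple had a null intersection at some radius, countably many of these
  null sets, with centres in finite nets and rational radii, would suffice. Almost every
  \<open>y\<close> avoids them all, yet \<open>n\<close> distinct points of its fibre are
  approximated by net points whose intersection is null and contains \<open>y\<close>.\<close>

lemma exists_positive_measure_fibre_tuple:
  assumes AE: "AE y in \<nu>. enat n \<le> fibre_card \<pi> y"
  shows "\<exists>xs. length xs = n \<and> distinct xs \<and>
    (\<forall>e>0. measure \<nu> (\<Inter>i\<in>{..<n}. \<pi> ` cball (xs ! i) e) > 0)"
proof (rule ccontr)
  assume neg: "\<not> ?thesis"
  have "\<exists>k. finite k \<and> (UNIV :: 'x set) \<subseteq> (\<Union>x\<in>k. ball x (1 / real (Suc m)))" for m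
    using compact_X unfolding compact_eq_totally_bounded by simp
  then obtain net where net: "\<And>m. finite (net m)" "\<And>m. (UNIV :: 'x set) \<subseteq> (\<Union>x\<in>net m. ball x (1 / real (Suc m)))"
    by metis
  define B where "B qs m = (\<Inter>i\<in>{..<n}. \<pi> ` cball (qs ! i) (1 / real (Suc m)))" for qs :: "'x list" and m :: nat
  define I where "I = {(qs, m). qs \<in> lists (\<Union>m. net m) \<and> measure \<nu> (B qs m) = 0}"
  have "countable I"
  proof (rule countable_subset)
    show "I \<subseteq> lists (\<Union>m. net m) \<times> UNIV" by (auto simp: I_def)
    show "countable (lists (\<Union>m. net m) \<times> (UNIV :: nat set))"
      using net(1) by (intro countable_SIGMA countable_lists countable_UN) (auto intro: countable_finite)
  qed
  have closed_B: "closed (\<Inter>i\<in>{..<n}. \<pi> ` cball (qs ! i) e)" for qs e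
    using compact_imp_closed[OF compact_image_cball] by (intro closed_INT) auto
  have "AE y in \<nu>. \<forall>z\<in>I. y \<notin> B (fst z) (snd z)"
    unfolding AE_ball_countable[OF \<open>countable I\<close>]
  proof
    fix z assume "z \<in> I"
    then have "B (fst z) (snd z) \<in> null_sets \<nu>"
      using closed_B by (auto simp: I_def null_sets_def sets_nu B_def emeasure_eq_measure)
    then show "AE y in \<nu>. y \<notin> B (fst z) (snd z)" by (rule AE_not_in)
  qed
  with AE have "AE y in \<nu>. enat n \<le> fibre_card \<pi> y \<and> (\<forall>z\<in>I. y \<notin> B (fst z) (snd z))" by eventually_elim auto
  \<comment> \<open>The existence of a suitable \<open>y\<close> is written as a constant property,
    which holds almost everywhere in a probability space only if it is true.\<close>
  then have ae: "AE y in \<nu>. \<not> (\<forall>y. \<not> (enat n \<le> fibre_card \<pi> y \<and> (\<forall>z\<in>I. y \<notin> B (fst z) (snd z))))"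
    by (rule eventually_mono) blast
  have "\<exists>y. enat n \<le> fibre_card \<pi> y \<and> (\<forall>z\<in>I. y \<notin> B (fst z) (snd z))"
    using ae unfolding AE_const by blast
  then obtain y where y: "enat n \<le> fibre_card \<pi> y" "\<And>z. z \<in> I \<Longrightarrow> y \<notin> B (fst z) (snd z)"
    by blast
  obtain T where T: "T \<subseteq> \<pi> -` {y}" "card T = n" "finite T"
  proof (cases "finite (\<pi> -` {y})")
    case True
    then have "n \<le> card (\<pi> -` {y})" using y(1) by (simp add: fibre_card_def)
    then show ?thesis using that True obtain_subset_with_card_n by (metis finite_subset)
  next
    case False
    then show ?thesis using that infinite_arbitrarily_large by metis
  qed
  obtain xs where xs: "set xs = T" "distinct xs" using finite_distinct_list[OF T(3)] by blast
  have len: "length xs = n" using xs T(2) distinct_card by fastforce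
  obtain e where e: "e > 0" "measure \<nu> (\<Inter>i\<in>{..<n}. \<pi> ` cball (xs ! i) e) \<le> 0"
  proof -
    have "\<not> (\<forall>e>0. measure \<nu> (\<Inter>i\<in>{..<n}. \<pi> ` cball (xs ! i) e) > 0)"
      using neg xs(2) len by blast
    then show ?thesis using that by (auto simp: not_less)
  qed
  obtain m where m: "inverse (real (Suc m)) < e / 2" using reals_Archimedean[of "e / 2"] e(1) by auto
  have "\<exists>q\<in>net m. x \<in> ball q (1 / real (Suc m))" for x using net(2)[of m] by blast
  then obtain q where q: "\<And>x. q x \<in> net m" "\<And>x. dist (q x) x < 1 / real (Suc m)"
    by (metis mem_ball)
  have "B (map q xs) m \<subseteq> (\<Inter>i\<in>{..<n}. \<pi> ` cball (xs ! i) e)"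
  proof -
    have "cball (map q xs ! i) (1 / real (Suc m)) \<subseteq> cball (xs ! i) e" if i: "i \<in> {..<n}" for i
    proof
      fix z assume "z \<in> cball (map q xs ! i) (1 / real (Suc m))"
      then have "dist (q (xs ! i)) z \<le> 1 / real (Suc m)" using i len by simp
      then show "z \<in> cball (xs ! i) e"
        using q(2)[of "xs ! i"] m dist_triangle3[of "xs ! i" z "q (xs ! i)"] by (simp add: inverse_eq_divide)
    qed
    then show ?thesis unfolding B_def by blast
  qed
  then have "measure \<nu> (B (map q xs) m) \<le> 0"
    using e(2) closed_B[of xs e] finite_measure_mono[of "B (map q xs) m" "\<Inter>i\<in>{..<n}. \<pi> ` cball (xs ! i) e"]
    by (simp add: sets_nu)
  then have "(map q xs, m) \<in> I"
    using q(1) by (fastforce simp: I_def measure_le_0_iff)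
  then have "y \<notin> B (map q xs) m" using y(2) by fastforce
  moreover have "y \<in> B (map q xs) m"
    unfolding B_def
  proof (intro INT_I)
    fix i assume i: "i \<in> {..<n}"
    then have "\<pi> (xs ! i) = y" using T(1) xs(1) len by (auto dest!: nth_mem)
    then show "y \<in> \<pi> ` cball (map q xs ! i) (1 / real (Suc m))"
      using q(2)[of "xs ! i"] i len by (intro image_eqI[of _ _ "xs ! i"]) auto
  qed
  ultimately show False by blast
qed

end

section \<open>Independent balls and the passage to the IT-tuple\<close>

lemma finite_fibre_cases:
  assumes "fibre_card \<pi> y = enat k"
  obtains f where "bij_betw f {..<k} (\<pi> -` {y})"
proof -
  have "finite (\<pi> -` {y}) \<and> card (\<pi> -` {y}) = k"
    using assms by (auto simp: fibre_card_def split: if_splits)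
  then show ?thesis using that ex_bij_betw_nat_finite[of "\<pi> -` {y}"] by (auto simp: lessThan_atLeast0)
qed

text \<open>For finite \<open>K1 = k\<close>, an integer \<open>K\<close> is at most the ceiling of
  \<open>k / K2\<close> exactly when \<open>K - 1 < k / K2\<close>; clearing the denominator gives
  the number of fibre points used throughout.\<close>

lemma less_of_le_ceil_div:
  assumes "K2 > 0" "K \<ge> 1" "enat K \<le> ceil_div K1 K2"
  shows "enat (Suc ((K - 1) * K2)) \<le> K1"
proof (cases K1)
  case (enat k)
  then have "K \<le> nat \<lceil>real k / real K2\<rceil>" using assms(3) by (simp add: ceil_div_def)
  then have "int K \<le> \<lceil>real k / real K2\<rceil>" using assms(2) by linarith
  then have "real K - 1 < real k / real K2" by (simp add: le_ceiling_iff)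
  then have "(real K - 1) * real K2 < real k" using assms(1) by (simp add: field_simps)
  then have "real ((K - 1) * K2) < real k" using assms(2) by (simp add: of_nat_diff)
  then have "(K - 1) * K2 < k" by (simp only: of_nat_less_iff)
  then show ?thesis using enat by simp
qed simp

context equicontinuous_factor
begin

text \<open>A generic fibre in a prescribed open set has exactly \<open>k\<close> points, and labelling each time
  by the fibre point that realises its symbol splits every pattern into \<open>k\<close> realised ones.\<close>

lemma independent_subtuple_of_cballs:
  fixes K k :: nat
  assumes K: "K \<ge> 2" and k: "k > 0" and almost: "almost_K_to_one \<pi> k"
    and len: "length xs = Suc ((K - 1) * k)"
    and pos: "\<And>e. e > 0 \<Longrightarrow> measure \<nu> (\<Inter>i\<in>{..<length xs}. \<pi> ` cball (xs ! i) e) > 0"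
    and e: "e > 0"
    and disj: "\<And>i j. i < length xs \<Longrightarrow> j < length xs \<Longrightarrow> i \<noteq> j \<Longrightarrow> cball (xs ! i) e \<inter> cball (xs ! j) e = {}"
  shows "\<exists>S J. S \<subseteq> {..<length xs} \<and> card S = K \<and> infinite J \<and>
    (\<forall>I \<sigma>. finite I \<longrightarrow> I \<subseteq> J \<longrightarrow> (\<forall>g\<in>I. \<sigma> g \<in> S) \<longrightarrow> (\<exists>x. \<forall>g\<in>I. act g x \<in> cball (xs ! \<sigma> g) e))"
proof -
  define N where "N = length xs"
  define V where "V j = cball (xs ! j) e" for j
  define W where "W j = interior (\<pi> ` V j)" for j
  \<comment> \<open>Half the radius of the \<open>V j\<close> is the margin that puts
    \<open>D\<close> inside the closure of each \<open>W j\<close>.\<close>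
  define D where "D = (\<Inter>i\<in>{..<N}. \<pi> ` cball (xs ! i) (e / 2))"
  note X = G_system_bij[OF G_system_X]
  have D: "closed D" "measure \<nu> D > 0"
    using compact_imp_closed[OF compact_image_cball] pos[of "e / 2"] e
    unfolding D_def N_def by (auto intro!: closed_INT)
  have W: "open (W j)" "D \<subseteq> closure (W j)" if "j < N" for j
  proof -
    show "open (W j)" by (simp add: W_def)
    have "D \<subseteq> \<pi> ` cball (xs ! j) (e / 2)" using that by (auto simp: D_def)
    also have "\<dots> \<subseteq> closure (W j)"
      unfolding W_def V_def using e by (intro image_cball_subset_closure_interior) simp
    finally show "D \<subseteq> closure (W j)" .
  qed
  obtain s :: "nat \<Rightarrow> 'g" where s: "\<And>n \<sigma>. (\<And>i. i < n \<Longrightarrow> \<sigma> i < N) \<Longrightarrow> \<exists>u. \<forall>i<n. actH (s i) u \<in> W (\<sigma> i)"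
    using independent_sequence[of D N W, OF D W] by metis
  have generic: "\<exists>h\<in>U. fibre_card \<pi> h = enat k" if "open U" "U \<noteq> {}" for U
    using residual_dense[OF compact_H _ that] almost unfolding almost_K_to_one_def by blast
  \<comment> \<open>The sequence \<open>s\<close> may repeat, but an infinite set of indices must
    yield infinitely many group elements. If some \<open>g\<close> occurred infinitely often,
    \<open>N\<close> different symbols at its occurrences would give a generic fibre meeting
    \<open>N\<close> disjoint balls, although it has only \<open>k < N\<close> points.\<close>
  have fin: "finite {i. s i = g}" for g
  proof (rule ccontr)
    assume inf: "infinite {i. s i = g}"
    define r where "r = enumerate {i. s i = g}"
    have r: "strict_mono r" "s (r t) = g" for t
      using strict_mono_enumerate[OF inf] enumerate_in_set[OF inf, of t] by (auto simp: r_def)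
    \<comment> \<open>The occurrence of \<open>g\<close> with number \<open>t\<close> carries the
      symbol \<open>t\<close>; elsewhere the default 0 is legal because \<open>N\<close> is
      positive.\<close>
    define \<sigma> where "\<sigma> i = (if i \<in> r ` {..<N} then inv r i else 0)" for i
    have \<sigma>: "\<sigma> (r t) = t" if "t < N" for t
      using that strict_mono_imp_inj_on[OF r(1)] by (simp add: \<sigma>_def inv_f_f)
    have "\<sigma> i < N" for i
      using strict_mono_imp_inj_on[OF r(1)] by (auto simp: \<sigma>_def inv_f_f N_def len)
    from s[of "r N" \<sigma>, OF this] obtain u where u: "\<And>i. i < r N \<Longrightarrow> actH (s i) u \<in> W (\<sigma> i)" by blast
    have "actH g u \<in> (\<Inter>t\<in>{..<N}. W t)"
    proof
      fix t assume t: "t \<in> {..<N}"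
      then have "r t < r N" using r(1) by (simp add: strict_mono_less)
      from u[OF this] show "actH g u \<in> W t" using \<sigma> r(2) t by simp
    qed
    moreover have "open (\<Inter>t\<in>{..<N}. W t)" using W(1) by (intro open_INT) auto
    ultimately obtain h where h: "h \<in> (\<Inter>t\<in>{..<N}. W t)" "fibre_card \<pi> h = enat k"
      using generic by (metis empty_iff)
    have "\<exists>z. z \<in> V t \<and> \<pi> z = h" if "t < N" for t
    proof -
      have "h \<in> \<pi> ` V t" using h(1) that interior_subset by (fastforce simp: W_def)
      then show ?thesis by blast
    qed
    then obtain z where z: "\<And>t. t < N \<Longrightarrow> z t \<in> V t \<and> \<pi> (z t) = h" by metis
    have "inj_on z {..<N}"
    proof (intro inj_onI)
      fix t t' assume t: "t \<in> {..<N}" "t' \<in> {..<N}" "z t = z t'"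
      then have "z t \<in> cball (xs ! t) e \<inter> cball (xs ! t') e" using z[of t] z[of t'] by (auto simp: V_def)
      then show "t = t'" using disj[of t t'] t(1,2) by (cases "t = t'") (auto simp: N_def)
    qed
    moreover have "z ` {..<N} \<subseteq> \<pi> -` {h}" using z by auto
    moreover have "finite (\<pi> -` {h})" "card (\<pi> -` {h}) = k"
      using h(2) by (auto simp: fibre_card_def split: if_splits)
    ultimately have "N \<le> k" by (metis card_image card_lessThan card_mono)
    moreover have "k \<le> (K - 1) * k" using K by (cases "K - 1") auto
    ultimately show False unfolding N_def len by linarith
  qed
  define P where "P A \<longleftrightarrow> (\<exists>x. \<forall>(i, j)\<in>A. act (s i) x \<in> V j)" for A :: "(nat \<times> nat) set"
  have "\<exists>S J. S \<subseteq> {..<N} \<and> card S = K \<and> infinite J \<and>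
    (\<forall>I \<sigma>. finite I \<longrightarrow> I \<subseteq> J \<longrightarrow> (\<forall>i\<in>I. \<sigma> i \<in> S) \<longrightarrow> P ((\<lambda>i. (i, \<sigma> i)) ` I))"
  proof (rule uniform_pattern_extraction)
    show "P B" if "P A" "B \<subseteq> A" for A B using that unfolding P_def by blast
    show "(K - 1) * k < N" "0 < K" using len K by (auto simp: N_def)
    fix n and \<tau> :: "nat \<Rightarrow> nat" assume \<tau>: "\<And>i. \<tau> i < N"
    obtain u where u: "\<And>i. i < n \<Longrightarrow> actH (s i) u \<in> W (\<tau> i)" using s[of n \<tau>] \<tau> by blast
    have "open (\<Inter>i\<in>{..<n}. actH (s i) -` W (\<tau> i))"
      using W(1) \<tau> by (intro open_INT ballI open_vimage act_cont) auto
    moreover have "u \<in> (\<Inter>i\<in>{..<n}. actH (s i) -` W (\<tau> i))" using u by auto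
    ultimately obtain h where h: "\<And>i. i < n \<Longrightarrow> actH (s i) h \<in> W (\<tau> i)" "fibre_card \<pi> h = enat k"
      using generic[of "\<Inter>i\<in>{..<n}. actH (s i) -` W (\<tau> i)"] by auto
    obtain f where f: "bij_betw f {..<k} (\<pi> -` {h})" using finite_fibre_cases[OF h(2)] by blast
    have "\<exists>l<k. i < n \<longrightarrow> act (s i) (f l) \<in> V (\<tau> i)" for i
    proof (cases "i < n")
      case True
      then have "actH (s i) h \<in> \<pi> ` V (\<tau> i)" using h(1) interior_subset by (fastforce simp: W_def)
      then obtain w where w: "w \<in> V (\<tau> i)" "actH (s i) h = \<pi> w" by blast
      have "\<pi> (act (- s i) w) = h" using w(2) equivariant by (metis act_uminus(1))
      then have "act (- s i) w \<in> f ` {..<k}" using f by (simp add: bij_betw_def)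
      then obtain l where l: "l < k" "act (- s i) w = f l" by auto
      then have "act (s i) (f l) = w" using X(5) by metis
      then show ?thesis using l(1) w(1) by blast
    qed (use k in auto)
    then obtain c where c: "\<And>i. c i < k" "\<And>i. i < n \<Longrightarrow> act (s i) (f (c i)) \<in> V (\<tau> i)" by metis
    show "\<exists>c. (\<forall>i. c i < k) \<and> (\<forall>l<k. P ((\<lambda>i. (i, \<tau> i)) ` {i. i < n \<and> c i = l}))"
    proof (intro exI[of _ c] conjI allI impI c(1))
      fix l assume "l < k"
      show "P ((\<lambda>i. (i, \<tau> i)) ` {i. i < n \<and> c i = l})"
        unfolding P_def using c(2) by (intro exI[of _ "f l"]) auto
    qed
  qed
  then obtain S J where S: "S \<subseteq> {..<N}" "card S = K" and J: "infinite J"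
    and SJ: "\<forall>I \<sigma>. finite I \<longrightarrow> I \<subseteq> J \<longrightarrow> (\<forall>i\<in>I. \<sigma> i \<in> S) \<longrightarrow> P ((\<lambda>i. (i, \<sigma> i)) ` I)"
    by (elim exE conjE)
  have "infinite (s ` J)"
  proof
    assume "finite (s ` J)"
    then have "finite (\<Union>g\<in>s ` J. {i. s i = g})" using fin by blast
    moreover have "J \<subseteq> (\<Union>g\<in>s ` J. {i. s i = g})" by auto
    ultimately show False using J finite_subset by blast
  qed
  moreover have "\<exists>x. \<forall>g\<in>I. act g x \<in> cball (xs ! \<sigma> g) e"
    if I: "finite I" "I \<subseteq> s ` J" "\<forall>g\<in>I. \<sigma> g \<in> S" for I \<sigma>
  proof -
    obtain I' where I': "I' \<subseteq> J" "finite I'" "I = s ` I'" using finite_subset_image[OF I(1,2)] by blast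
    have "P ((\<lambda>i. (i, \<sigma> (s i))) ` I')" using I(3) I' by (intro SJ[rule_format]) auto
    then show ?thesis unfolding P_def V_def using I'(3) by auto
  qed
  ultimately show ?thesis using S unfolding N_def
    by (intro exI[of _ S] exI[of _ "s ` J"] conjI allI impI) auto
qed

text \<open>The set of \<open>K\<close> symbols found for radius \<open>\<epsilon> n\<close> may
  vary with \<open>n\<close>, but it ranges over finitely many sets, so one recurs at arbitrarily
  small radii. The independence sets may keep varying, as an IT-tuple asks for one per
  neighbourhood.\<close>

lemma exists_nontrivial_IT_tuple:
  fixes K k :: nat
  assumes K: "K \<ge> 2" and k: "k > 0" and almost: "almost_K_to_one \<pi> k"
    and AE: "AE y in \<nu>. enat (Suc ((K - 1) * k)) \<le> fibre_card \<pi> y"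
  shows "IT K act - diag K \<noteq> {}"
proof -
  define N where "N = Suc ((K - 1) * k)"
  obtain xs where xs: "length xs = N" "distinct xs"
    "\<And>e. e > 0 \<Longrightarrow> measure \<nu> (\<Inter>i\<in>{..<N}. \<pi> ` cball (xs ! i) e) > 0"
    using exists_positive_measure_fibre_tuple[OF AE] unfolding N_def by blast
  obtain d where d: "d > 0" "\<And>i j. i < length xs \<Longrightarrow> j < length xs \<Longrightarrow> i \<noteq> j \<Longrightarrow>
    cball (xs ! i) d \<inter> cball (xs ! j) d = {}" using distinct_balls_disjoint[OF xs(2)] by blast
  define ind where "ind e S J \<longleftrightarrow> S \<subseteq> {..<N} \<and> card S = K \<and> infinite J \<and>
    (\<forall>I \<sigma>. finite I \<longrightarrow> I \<subseteq> J \<longrightarrow> (\<forall>g\<in>I. \<sigma> g \<in> S) \<longrightarrow> (\<exists>x. \<forall>g\<in>I. act g x \<in> cball (xs ! \<sigma> g) e))"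
    for e S and J :: "'g set"
  define \<epsilon> where "\<epsilon> n = d / real (Suc n)" for n
  have "\<exists>S J. ind (\<epsilon> n) S J" for n
    unfolding ind_def xs(1)[symmetric]
  proof (rule independent_subtuple_of_cballs[OF K k almost])
    have "\<epsilon> n \<le> d" using d(1) by (simp add: \<epsilon>_def field_simps)
    then have sub: "cball (xs ! i) (\<epsilon> n) \<subseteq> cball (xs ! i) d" for i by auto
    show "cball (xs ! i) (\<epsilon> n) \<inter> cball (xs ! j) (\<epsilon> n) = {}"
      if "i < length xs" "j < length xs" "i \<noteq> j" for i j
      using d(2)[OF that] sub by blast
  qed (use xs d(1) in \<open>auto simp: N_def \<epsilon>_def\<close>)
  then obtain S J where SJ: "\<And>n. ind (\<epsilon> n) (S n) (J n)" by metis
  have "finite (range S)"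
  proof (rule finite_subset)
    have "S n \<subseteq> {..<N}" for n using SJ[of n] by (simp add: ind_def)
    then show "range S \<subseteq> Pow {..<N}" by blast
  qed simp
  from pigeonhole_infinite[OF infinite_UNIV_nat this] obtain n0 where inf: "infinite {n. S n = S n0}" by auto
  define T where "T = sorted_list_of_set (S n0)"
  have "finite (S n0)" using SJ[of n0] finite_subset by (auto simp: ind_def)
  then have T: "set T = S n0" "distinct T" "length T = K"
    using SJ[of n0] by (auto simp: T_def ind_def)
  have TN: "T ! i < N" if "i < K" for i using that T SJ[of n0] nth_mem[of i T] by (auto simp: ind_def)
  define ys where "ys = map ((!) xs) T"
  have "IT_tuple act ys"
    unfolding IT_tuple_def
  proof (intro allI impI)
    fix Us :: "'x set list"
    assume Us: "length Us = length ys \<and> (\<forall>i<length ys. open (Us ! i) \<and> ys ! i \<in> Us ! i)"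
    have lenU: "length Us = K" using Us T(3) by (simp add: ys_def)
    have "eventually (\<lambda>n. \<forall>i\<in>{..<K}. cball (ys ! i) (\<epsilon> n) \<subseteq> Us ! i) sequentially"
    proof (intro eventually_ball_finite ballI)
      fix i assume "i \<in> {..<K}"
      then obtain e where e: "e > 0" "cball (ys ! i) e \<subseteq> Us ! i"
        using Us lenU by (metis lessThan_iff open_contains_cball)
      have "\<epsilon> \<longlonglongrightarrow> 0" unfolding \<epsilon>_def using LIMSEQ_Suc[OF lim_const_over_n[of d]] by simp
      then have "eventually (\<lambda>n. \<epsilon> n < e) sequentially" using e(1) by (rule order_tendstoD)
      then show "eventually (\<lambda>n. cball (ys ! i) (\<epsilon> n) \<subseteq> Us ! i) sequentially"
        by eventually_elim (use e(2) in force)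
    qed simp
    moreover have "frequently (\<lambda>n. S n = S n0) sequentially"
      using inf by (simp add: frequently_cofinite[symmetric] cofinite_eq_sequentially)
    ultimately have "frequently (\<lambda>n. S n = S n0 \<and> (\<forall>i\<in>{..<K}. cball (ys ! i) (\<epsilon> n) \<subseteq> Us ! i)) sequentially"
      by (rule frequently_eventually_frequently[rotated])
    then obtain n where n: "S n = S n0" "\<And>i. i < K \<Longrightarrow> cball (ys ! i) (\<epsilon> n) \<subseteq> Us ! i"
      by (auto dest: frequently_ex)
    have "independence_set act Us (J n)"
      unfolding independence_set_def
    proof (intro allI impI)
      fix I \<sigma> assume I: "finite I \<and> I \<noteq> {} \<and> I \<subseteq> J n \<and> (\<forall>s\<in>I. \<sigma> s < length Us)"
      have "\<exists>x. \<forall>g\<in>I. act g x \<in> cball (xs ! (T ! \<sigma> g)) (\<epsilon> n)"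
      proof -
        have "\<forall>g\<in>I. T ! \<sigma> g \<in> S n" using I lenU T n(1) nth_mem by metis
        then show ?thesis
          using SJ[of n, unfolded ind_def, THEN conjunct2, THEN conjunct2, THEN conjunct2,
            rule_format, of I "\<lambda>g. T ! \<sigma> g"] I by simp
      qed
      then obtain x where x: "\<And>g. g \<in> I \<Longrightarrow> act g x \<in> cball (ys ! \<sigma> g) (\<epsilon> n)"
        using I lenU T(3) by (auto simp: ys_def)
      then have "x \<in> (\<Inter>s\<in>I. act s -` (Us ! \<sigma> s))" using n(2) I lenU by fastforce
      then show "(\<Inter>s\<in>I. act s -` (Us ! \<sigma> s)) \<noteq> {}" by blast
    qed
    then show "\<exists>J. infinite J \<and> independence_set act Us J" using SJ[of n] by (auto simp: ind_def)
  qed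
  moreover have "ys \<notin> diag K"
    using T TN xs(1,2) by (auto simp: diag_def ys_def nth_eq_iff_index_eq)
  moreover have "length ys = K" using T(3) by (simp add: ys_def)
  ultimately show ?thesis by (auto simp: IT_def)
qed

end

theorem theorem1p5:
  fixes act :: "'g::{group_add, countable} \<Rightarrow> 'x::metric_space \<Rightarrow> 'x"
    and actH :: "'g \<Rightarrow> 'h::metric_space \<Rightarrow> 'h"
    and \<pi> :: "'x \<Rightarrow> 'h"
    and \<nu> :: "'h measure"
    and K1 :: enat and K2 :: nat
  assumes "infinite (UNIV :: 'g set)"
    and "compact (UNIV :: 'x set)"
    and "G_system act"
    and "minimal_system act"
    and "max_equicontinuous_factor act actH \<pi>"
    and "haar_measure actH \<nu>"
    and "AE y in \<nu>. fibre_card \<pi> y = K1"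
    and "almost_K_to_one \<pi> K2"
    and "ceil_div K1 K2 \<ge> 2"
  shows "\<forall>K::nat. 2 \<le> K \<and> enat K \<le> ceil_div K1 K2 \<longrightarrow> IT K act - diag K \<noteq> {}"
proof (intro allI impI)
  fix K :: nat assume K: "2 \<le> K \<and> enat K \<le> ceil_div K1 K2"
  have H: "compact (UNIV :: 'h set)" "G_system actH" "equicontinuous_on UNIV actH"
    "continuous_on UNIV \<pi>" "surj \<pi>" "\<forall>g x. \<pi> (act g x) = actH g (\<pi> x)"
    using assms(5) unfolding max_equicontinuous_factor_def by - (elim conjE, assumption)+
  have equiv: "\<pi> (act g x) = actH g (\<pi> x)" for g x using H(6) by simp
  have "minimal_system actH"
    by (rule minimal_system_factor[where \<pi> = \<pi>, OF assms(4) H(4) H(5) equiv])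
  interpret equicontinuous_factor actH \<nu> act \<pi>
    by (intro equicontinuous_factor.intro equicontinuous_minimal.intro equicontinuous_factor_axioms.intro)
      (fact H assms equiv \<open>minimal_system actH\<close>)+
  \<comment> \<open>Some fibre has exactly \<open>K2\<close> points and surjectivity makes it
    nonempty, which gives \<open>K2 > 0\<close>.\<close>
  have "residual {h. fibre_card \<pi> h = enat K2}" using assms(8) by (simp add: almost_K_to_one_def)
  from residual_dense[OF H(1) this, of UNIV] obtain h where h: "fibre_card \<pi> h = enat K2" by auto
  then have "finite (\<pi> -` {h})" "card (\<pi> -` {h}) = K2"
    by (auto simp: fibre_card_def split: if_splits)
  moreover obtain x where "h = \<pi> x" using H(5) by (rule surjE)
  then have "x \<in> \<pi> -` {h}" by simp
  ultimately have K2: "K2 > 0" by (metis card_gt_0_iff empty_iff)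
  have "enat (Suc ((K - 1) * K2)) \<le> K1"
    using less_of_le_ceil_div[OF K2, of K K1] K by simp
  with assms(7) have "AE y in \<nu>. enat (Suc ((K - 1) * K2)) \<le> fibre_card \<pi> y"
    by (auto elim: eventually_mono)
  with K K2 assms(8) show "IT K act - diag K \<noteq> {}"
    by (intro exists_nontrivial_IT_tuple) auto
qed

end
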